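(* The system $\mathsf{Z}_2^{\omega}+\bigcup_{\sigma}\mathsf{QF\text{-}AC}^{\sigma,1}$ (where $\sigma$ ranges over all finite types) does not prove $\mathsf{NIN}_{[0,1]}$, where $\mathsf{NIN}_{[0,1]}$ is the sentence: for any $Y:[0,1]\to\mathbb{N}$, there are $x,y\in[0,1]$ such that $x\neq_{\mathbb{R}}y$ and $Y(x)=_{\mathbb{N}}Y(y)$.
   Context: The metatheory is $\mathsf{ZFC}$. Finite types: $0$ is the type of natural numbers; if $\sigma,\tau$ are types then so is $\sigma\to\tau$; $1=0\to0$ (elements of $\mathbb{N}^{\mathbb{N}}$), $2=1\to 0$, $n+1=n\to0$. The only primitive predicate of the language is equality $=_0$ at type $0$; equality at higher types is defined extensionally (pointwise). $\mathsf{RCA}_0^{\omega}$ is Kohlenbach's base theory of higher-order Reverse Mathematics, i.e. E-PRA$^{\omega}$ + $\mathsf{QF\text{-}AC}^{1,0}$: classical many-sorted logic in the language of finite types with the usual axioms for $0$ and successor, the combinators $\Pi,\Sigma$ for all types, the primitive recursor $\mathbf{R}_0$ (recursion with values of type $0$), quantifier-free induction, the axiom of extensionality at all finite types, and $\mathsf{QF\text{-}AC}^{1,0}$. $\mathsf{QF\text{-}AC}^{\sigma,\tau}$: for every quantifier-free formula $\varphi$ (parameters of any finite type allowed), $(\forall f^{\sigma})(\exists g^{\tau})\varphi(f,g)\to(\exists\Phi^{\sigma\to\tau})(\forall f^{\sigma})\varphi(f,\Phi(f))$. For $k\geq 1$, $(\mathsf{S}_k^2)$ is the axiom stating that there is a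 functional $\mathsf{S}_k^2:\mathbb{N}^{\mathbb{N}}\to\{0,1\}$ deciding $\Sigma^1_k$-formulas in normal form, i.e. for all $f\in\mathbb{N}^{\mathbb{N}}$, $\mathsf{S}^2_k(f)=0\leftrightarrow(\exists g_1)(\forall g_2)\cdots(Qg_k)(Q'n)\,\big(f(\langle\overline{g_1}n,\dots,\overline{g_k}n\rangle)=0\big)$, with $g_i$ ranging over $\mathbb{N}^{\mathbb{N}}$, $n$ over $\mathbb{N}$, alternating quantifiers, $\overline{g}n$ the code of the finite sequence $(g(0),\dots,g(n-1))$; for $k=1$: $\mathsf{S}_1^2(f)=0\leftrightarrow(\exists g)(\forall n)(f(\overline{g}n)=0)$. $\Pi^1_k\text{-}\mathsf{CA}_0^{\omega}$ is $\mathsf{RCA}_0^{\omega}+(\mathsf{S}_k^2)$, and $\mathsf{Z}_2^{\omega}=\bigcup_k\Pi^1_k\text{-}\mathsf{CA}_0^{\omega}$. Real numbers are represented by fast-converging Cauchy sequences of rationals, $=_{\mathbb{R}}$ is the usual equality of representations, and functions on (subsets of) $\mathbb{R}$ are functionals on representations that respect $=_{\mathbb{R}}$. *)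

theory Defs
  imports Main
begin

section \<open>Syntax: finite types, combinatory terms, many-sorted formulas\<close>

datatype ty = N | Fun ty ty  (infixr "\<rightarrow>\<^sub>t" 70)

abbreviation T1 :: ty where "T1 \<equiv> N \<rightarrow>\<^sub>t N"
abbreviation T2 :: ty where "T2 \<equiv> T1 \<rightarrow>\<^sub>t N"

type_synonym var = "nat \<times> ty"

datatype tm =
    Var var
  | Zero
  | Succ
  | Kc ty ty         \<comment> \<open>the combinator \<open>\<Pi>\<close>\<close>
  | Sc ty ty ty      \<comment> \<open>the combinator \<open>\<Sigma>\<close>\<close>
  | Rec0             \<comment> \<open>the recursor \<open>R\<^sub>0\<close> with values of type \<open>N\<close>\<close>
  | App tm tm  (infixl "\<cdot>" 90)

text \<open>The type of a term; the value on ill-typed terms is irrelevant.\<close>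

primrec ty_of :: "tm \<Rightarrow> ty" where
  "ty_of (Var v) = snd v"
| "ty_of Zero = N"
| "ty_of Succ = N \<rightarrow>\<^sub>t N"
| "ty_of (Kc \<sigma> \<tau>) = \<sigma> \<rightarrow>\<^sub>t \<tau> \<rightarrow>\<^sub>t \<sigma>"
| "ty_of (Sc \<rho> \<sigma> \<tau>) = (\<rho> \<rightarrow>\<^sub>t \<sigma> \<rightarrow>\<^sub>t \<tau>) \<rightarrow>\<^sub>t (\<rho> \<rightarrow>\<^sub>t \<sigma>) \<rightarrow>\<^sub>t \<rho> \<rightarrow>\<^sub>t \<tau>"
| "ty_of Rec0 = (N \<rightarrow>\<^sub>t N \<rightarrow>\<^sub>t N) \<rightarrow>\<^sub>t N \<rightarrow>\<^sub>t N \<rightarrow>\<^sub>t N"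
| "ty_of (s \<cdot> t) = (case ty_of s of N \<Rightarrow> N | _ \<rightarrow>\<^sub>t \<tau> \<Rightarrow> \<tau>)"

primrec wt :: "tm \<Rightarrow> bool" where
  "wt (Var v) = True"
| "wt Zero = True"
| "wt Succ = True"
| "wt (Kc \<sigma> \<tau>) = True"
| "wt (Sc \<rho> \<sigma> \<tau>) = True"
| "wt Rec0 = True"
| "wt (s \<cdot> t) = (wt s \<and> wt t \<and> (\<exists>\<tau>. ty_of s = ty_of t \<rightarrow>\<^sub>t \<tau>))"

primrec fv_tm :: "tm \<Rightarrow> var set" where
  "fv_tm (Var v) = {v}"
| "fv_tm Zero = {}"
| "fv_tm Succ = {}"
| "fv_tm (Kc \<sigma> \<tau>) = {}"
| "fv_tm (Sc \<rho> \<sigma> \<tau>) = {}"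
| "fv_tm Rec0 = {}"
| "fv_tm (s \<cdot> t) = fv_tm s \<union> fv_tm t"

primrec subst_tm :: "var \<Rightarrow> tm \<Rightarrow> tm \<Rightarrow> tm" where
  "subst_tm v r (Var w) = (if w = v then r else Var w)"
| "subst_tm v r Zero = Zero"
| "subst_tm v r Succ = Succ"
| "subst_tm v r (Kc \<sigma> \<tau>) = Kc \<sigma> \<tau>"
| "subst_tm v r (Sc \<rho> \<sigma> \<tau>) = Sc \<rho> \<sigma> \<tau>"
| "subst_tm v r Rec0 = Rec0"
| "subst_tm v r (s \<cdot> t) = subst_tm v r s \<cdot> subst_tm v r t"

datatype fm =
    Eq tm tm  (infix "\<^bold>=" 50)
  | Falsum
  | Imp fm fm  (infixr "\<^bold>\<longrightarrow>" 25)
  | Forall var fm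

definition Neg :: "fm \<Rightarrow> fm"  ("\<^bold>\<not> _" [40] 40)
  where "(\<^bold>\<not> \<phi>) = (\<phi> \<^bold>\<longrightarrow> Falsum)"
definition Conj :: "fm \<Rightarrow> fm \<Rightarrow> fm"  (infixr "\<^bold>\<and>" 35)
  where "(\<phi> \<^bold>\<and> \<psi>) = (\<^bold>\<not> (\<phi> \<^bold>\<longrightarrow> \<^bold>\<not> \<psi>))"
definition Disj :: "fm \<Rightarrow> fm \<Rightarrow> fm"  (infixr "\<^bold>\<or>" 30)
  where "(\<phi> \<^bold>\<or> \<psi>) = (\<^bold>\<not> \<phi> \<^bold>\<longrightarrow> \<psi>)"
definition Iff :: "fm \<Rightarrow> fm \<Rightarrow> fm"  (infixr "\<^bold>\<longleftrightarrow>" 25)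
  where "(\<phi> \<^bold>\<longleftrightarrow> \<psi>) = ((\<phi> \<^bold>\<longrightarrow> \<psi>) \<^bold>\<and> (\<psi> \<^bold>\<longrightarrow> \<phi>))"
definition Exists :: "var \<Rightarrow> fm \<Rightarrow> fm"
  where "Exists v \<phi> = (\<^bold>\<not> Forall v (\<^bold>\<not> \<phi>))"

text \<open>Well-formed formulas: equality is primitive at type \<open>N\<close> only.\<close>

primrec wff :: "fm \<Rightarrow> bool" where
  "wff (s \<^bold>= t) = (wt s \<and> wt t \<and> ty_of s = N \<and> ty_of t = N)"
| "wff Falsum = True"
| "wff (\<phi> \<^bold>\<longrightarrow> \<psi>) = (wff \<phi> \<and> wff \<psi>)"
| "wff (Forall v \<phi>) = wff \<phi>"

primrec qf :: "fm \<Rightarrow> bool" where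
  "qf (s \<^bold>= t) = True"
| "qf Falsum = True"
| "qf (\<phi> \<^bold>\<longrightarrow> \<psi>) = (qf \<phi> \<and> qf \<psi>)"
| "qf (Forall v \<phi>) = False"

primrec fv :: "fm \<Rightarrow> var set" where
  "fv (s \<^bold>= t) = fv_tm s \<union> fv_tm t"
| "fv Falsum = {}"
| "fv (\<phi> \<^bold>\<longrightarrow> \<psi>) = fv \<phi> \<union> fv \<psi>"
| "fv (Forall v \<phi>) = fv \<phi> - {v}"

primrec subst :: "var \<Rightarrow> tm \<Rightarrow> fm \<Rightarrow> fm" where
  "subst v r (s \<^bold>= t) = (subst_tm v r s \<^bold>= subst_tm v r t)"
| "subst v r Falsum = Falsum"
| "subst v r (\<phi> \<^bold>\<longrightarrow> \<psi>) = (subst v r \<phi> \<^bold>\<longrightarrow> subst v r \<psi>)"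
| "subst v r (Forall w \<phi>) = Forall w (if w = v then \<phi> else subst v r \<phi>)"

text \<open>Substitution does not rename bound variables: \<open>free_for v r \<phi>\<close> states that no variable
  of \<open>r\<close> is captured when \<open>r\<close> replaces the free occurrences of \<open>v\<close> in \<open>\<phi>\<close>.\<close>

primrec free_for :: "var \<Rightarrow> tm \<Rightarrow> fm \<Rightarrow> bool" where
  "free_for v r (s \<^bold>= t) = True"
| "free_for v r Falsum = True"
| "free_for v r (\<phi> \<^bold>\<longrightarrow> \<psi>) = (free_for v r \<phi> \<and> free_for v r \<psi>)"
| "free_for v r (Forall w \<phi>) = (v \<notin> fv (Forall w \<phi>) \<or> (w \<notin> fv_tm r \<and> free_for v r \<phi>))"


section \<open>Classical many-sorted logic\<close>

text \<open>A Hilbert calculus. Because of the unrestricted generalisation rule, open axioms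
  stand for their universal closures.\<close>

inductive derives :: "fm set \<Rightarrow> fm \<Rightarrow> bool"  (infix "\<turnstile>" 20) for T :: "fm set" where
  axiom: "\<phi> \<in> T \<Longrightarrow> T \<turnstile> \<phi>"
| imp_K: "\<lbrakk>wff \<phi>; wff \<psi>\<rbrakk> \<Longrightarrow> T \<turnstile> (\<phi> \<^bold>\<longrightarrow> \<psi> \<^bold>\<longrightarrow> \<phi>)"
| imp_S: "\<lbrakk>wff \<phi>; wff \<psi>; wff \<chi>\<rbrakk> \<Longrightarrow>
    T \<turnstile> ((\<phi> \<^bold>\<longrightarrow> \<psi> \<^bold>\<longrightarrow> \<chi>) \<^bold>\<longrightarrow> (\<phi> \<^bold>\<longrightarrow> \<psi>) \<^bold>\<longrightarrow> \<phi> \<^bold>\<longrightarrow> \<chi>)"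
| dneg: "wff \<phi> \<Longrightarrow> T \<turnstile> ((\<^bold>\<not> \<^bold>\<not> \<phi>) \<^bold>\<longrightarrow> \<phi>)"
| inst: "\<lbrakk>wff \<phi>; wt t; ty_of t = snd v; free_for v t \<phi>\<rbrakk> \<Longrightarrow>
    T \<turnstile> (Forall v \<phi> \<^bold>\<longrightarrow> subst v t \<phi>)"
| distr: "\<lbrakk>wff \<phi>; wff \<psi>; v \<notin> fv \<phi>\<rbrakk> \<Longrightarrow>
    T \<turnstile> (Forall v (\<phi> \<^bold>\<longrightarrow> \<psi>) \<^bold>\<longrightarrow> \<phi> \<^bold>\<longrightarrow> Forall v \<psi>)"
| mp: "\<lbrakk>T \<turnstile> (\<phi> \<^bold>\<longrightarrow> \<psi>); T \<turnstile> \<phi>\<rbrakk> \<Longrightarrow> T \<turnstile> \<psi>"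
| gen: "T \<turnstile> \<phi> \<Longrightarrow> T \<turnstile> Forall v \<phi>"


section \<open>The base theory\<close>

text \<open>An index above all variable indices of a term.\<close>

primrec fresh :: "tm \<Rightarrow> nat" where
  "fresh (Var v) = Suc (fst v)"
| "fresh Zero = 0"
| "fresh Succ = 0"
| "fresh (Kc \<sigma> \<tau>) = 0"
| "fresh (Sc \<rho> \<sigma> \<tau>) = 0"
| "fresh Rec0 = 0"
| "fresh (s \<cdot> t) = max (fresh s) (fresh t)"

text \<open>Extensional equality at all finite types.\<close>

primrec eq_at :: "ty \<Rightarrow> tm \<Rightarrow> tm \<Rightarrow> fm" where
  "eq_at N = (\<lambda>s t. s \<^bold>= t)"
| "eq_at (\<sigma> \<rightarrow>\<^sub>t \<tau>) = (\<lambda>s t. let y = (max (fresh s) (fresh t), \<sigma>)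
     in Forall y (eq_at \<tau> (s \<cdot> Var y) (t \<cdot> Var y)))"

text \<open>In \<open>QF_AC\<close> no clashes between \<open>x\<close>, \<open>y\<close> and \<open>\<Phi>\<close> other than the excluded
  ones are possible, and \<open>\<Phi> \<cdot> x\<close> cannot be captured as \<open>\<phi>\<close> has no quantifiers.\<close>

definition QF_AC :: "ty \<Rightarrow> ty \<Rightarrow> fm set" where
  "QF_AC \<sigma> \<tau> = {(Forall x (Exists y \<phi>) \<^bold>\<longrightarrow>
      Exists \<Phi> (Forall x (subst y (Var \<Phi> \<cdot> Var x) \<phi>))) | x y \<Phi> \<phi>.
      qf \<phi> \<and> wff \<phi> \<and> snd x = \<sigma> \<and> snd y = \<tau> \<and> snd \<Phi> = \<sigma> \<rightarrow>\<^sub>t \<tau> \<and> x \<noteq> y \<and> \<Phi> \<notin> fv \<phi>}"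

abbreviation V :: "nat \<Rightarrow> ty \<Rightarrow> tm" where "V i \<sigma> \<equiv> Var (i, \<sigma>)"

inductive_set E_PRA :: "fm set" where
  eq_refl: "(V 0 N \<^bold>= V 0 N) \<in> E_PRA"
| eq_sym: "(V 0 N \<^bold>= V 1 N \<^bold>\<longrightarrow> V 1 N \<^bold>= V 0 N) \<in> E_PRA"
| eq_trans: "(V 0 N \<^bold>= V 1 N \<^bold>\<longrightarrow> V 1 N \<^bold>= V 2 N \<^bold>\<longrightarrow> V 0 N \<^bold>= V 2 N) \<in> E_PRA"
| succ_nonzero: "(\<^bold>\<not> Succ \<cdot> V 0 N \<^bold>= Zero) \<in> E_PRA"
| succ_inj: "(Succ \<cdot> V 0 N \<^bold>= Succ \<cdot> V 1 N \<^bold>\<longrightarrow> V 0 N \<^bold>= V 1 N) \<in> E_PRA"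
| comb_K: "eq_at \<sigma> (Kc \<sigma> \<tau> \<cdot> V 0 \<sigma> \<cdot> V 1 \<tau>) (V 0 \<sigma>) \<in> E_PRA"
| comb_S: "eq_at \<tau>
    (Sc \<rho> \<sigma> \<tau> \<cdot> V 0 (\<rho> \<rightarrow>\<^sub>t \<sigma> \<rightarrow>\<^sub>t \<tau>) \<cdot> V 1 (\<rho> \<rightarrow>\<^sub>t \<sigma>) \<cdot> V 2 \<rho>)
    (V 0 (\<rho> \<rightarrow>\<^sub>t \<sigma> \<rightarrow>\<^sub>t \<tau>) \<cdot> V 2 \<rho> \<cdot> (V 1 (\<rho> \<rightarrow>\<^sub>t \<sigma>) \<cdot> V 2 \<rho>)) \<in> E_PRA"
| rec_0: "(Rec0 \<cdot> V 0 (N \<rightarrow>\<^sub>t N \<rightarrow>\<^sub>t N) \<cdot> V 1 N \<cdot> Zero \<^bold>= V 1 N) \<in> E_PRA"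
| rec_Succ: "(Rec0 \<cdot> V 0 (N \<rightarrow>\<^sub>t N \<rightarrow>\<^sub>t N) \<cdot> V 1 N \<cdot> (Succ \<cdot> V 2 N) \<^bold>=
    V 0 (N \<rightarrow>\<^sub>t N \<rightarrow>\<^sub>t N) \<cdot> V 2 N \<cdot> (Rec0 \<cdot> V 0 (N \<rightarrow>\<^sub>t N \<rightarrow>\<^sub>t N) \<cdot> V 1 N \<cdot> V 2 N)) \<in> E_PRA"
| qf_induction: "\<lbrakk>qf \<phi>; wff \<phi>; snd x = N\<rbrakk> \<Longrightarrow>
    ((subst x Zero \<phi> \<^bold>\<and> Forall x (\<phi> \<^bold>\<longrightarrow> subst x (Succ \<cdot> Var x) \<phi>)) \<^bold>\<longrightarrow> Forall x \<phi>) \<in> E_PRA"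
| extensionality: "(eq_at \<sigma> (V 0 \<sigma>) (V 1 \<sigma>) \<^bold>\<longrightarrow>
    eq_at \<tau> (V 2 (\<sigma> \<rightarrow>\<^sub>t \<tau>) \<cdot> V 0 \<sigma>) (V 2 (\<sigma> \<rightarrow>\<^sub>t \<tau>) \<cdot> V 1 \<sigma>)) \<in> E_PRA"

definition RCA0_omega :: "fm set" where
  "RCA0_omega = E_PRA \<union> QF_AC T1 N"


section \<open>Primitive recursive terms\<close>

text \<open>Bracket abstraction: \<open>lam v t\<close> is the usual combinatory rendering of \<open>\<lambda>v. t\<close>.\<close>

primrec lam :: "var \<Rightarrow> tm \<Rightarrow> tm" where
  "lam v (Var w) = (if w = v
     then Sc (snd v) (snd v \<rightarrow>\<^sub>t snd v) (snd v) \<cdot> Kc (snd v) (snd v \<rightarrow>\<^sub>t snd v) \<cdot> Kc (snd v) (snd v)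
     else Kc (snd w) (snd v) \<cdot> Var w)"
| "lam v Zero = Kc N (snd v) \<cdot> Zero"
| "lam v Succ = Kc (ty_of Succ) (snd v) \<cdot> Succ"
| "lam v (Kc \<sigma> \<tau>) = Kc (ty_of (Kc \<sigma> \<tau>)) (snd v) \<cdot> Kc \<sigma> \<tau>"
| "lam v (Sc \<rho> \<sigma> \<tau>) = Kc (ty_of (Sc \<rho> \<sigma> \<tau>)) (snd v) \<cdot> Sc \<rho> \<sigma> \<tau>"
| "lam v Rec0 = Kc (ty_of Rec0) (snd v) \<cdot> Rec0"
| "lam v (s \<cdot> t) = (if v \<in> fv_tm (s \<cdot> t)
     then Sc (snd v) (ty_of t) (ty_of (s \<cdot> t)) \<cdot> lam v s \<cdot> lam v t
     else Kc (ty_of (s \<cdot> t)) (snd v) \<cdot> (s \<cdot> t))"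

abbreviation lam0 :: "nat \<Rightarrow> tm \<Rightarrow> tm" where "lam0 i t \<equiv> lam (i, N) t"
abbreviation "n0 \<equiv> V 0 N"
abbreviation "n1 \<equiv> V 1 N"
abbreviation "n2 \<equiv> V 2 N"
abbreviation "n3 \<equiv> V 3 N"

definition One :: tm where "One = Succ \<cdot> Zero"
definition Add :: tm where
  "Add = lam0 0 (lam0 1 (Rec0 \<cdot> lam0 2 (lam0 3 (Succ \<cdot> n3)) \<cdot> n0 \<cdot> n1))"
definition Mul :: tm where
  "Mul = lam0 0 (lam0 1 (Rec0 \<cdot> lam0 2 (lam0 3 (Add \<cdot> n3 \<cdot> n0)) \<cdot> Zero \<cdot> n1))"
definition Pred :: tm where
  "Pred = lam0 0 (Rec0 \<cdot> lam0 2 (lam0 3 n2) \<cdot> Zero \<cdot> n0)"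
definition Monus :: tm where
  "Monus = lam0 0 (lam0 1 (Rec0 \<cdot> lam0 2 (lam0 3 (Pred \<cdot> n3)) \<cdot> n0 \<cdot> n1))"
definition Exp2 :: tm where
  "Exp2 = lam0 0 (Rec0 \<cdot> lam0 2 (lam0 3 (Add \<cdot> n3 \<cdot> n3)) \<cdot> One \<cdot> n0)"

text \<open>The Cantor pairing \<open>(m, n) \<mapsto> (m + n)(m + n + 1)/2 + n\<close> and its inverses;
  \<open>Root \<cdot> n\<close> is the largest \<open>r\<close> with \<open>r(r + 1)/2 \<le> n\<close>.\<close>

definition Tri :: tm where
  "Tri = lam0 0 (Rec0 \<cdot> lam0 2 (lam0 3 (Add \<cdot> n3 \<cdot> (Succ \<cdot> n2))) \<cdot> Zero \<cdot> n0)"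
definition CPair :: tm where
  "CPair = lam0 0 (lam0 1 (Add \<cdot> (Tri \<cdot> (Add \<cdot> n0 \<cdot> n1)) \<cdot> n1))"
definition Root :: tm where
  "Root = lam0 0 (Rec0 \<cdot> lam0 2 (lam0 3
     (Add \<cdot> n3 \<cdot> (Monus \<cdot> One \<cdot> (Monus \<cdot> (Tri \<cdot> (Succ \<cdot> n3)) \<cdot> (Succ \<cdot> n2))))) \<cdot> Zero \<cdot> n0)"
definition Snd :: tm where
  "Snd = lam0 0 (Monus \<cdot> n0 \<cdot> (Tri \<cdot> (Root \<cdot> n0)))"
definition Fst :: tm where
  "Fst = lam0 0 (Monus \<cdot> (Root \<cdot> n0) \<cdot> (Snd \<cdot> n0))"

text \<open>\<open>Bar \<cdot> g \<cdot> n\<close> is the code of \<open>(g 0, \<dots>, g (n - 1))\<close>: the empty sequence has code \<open>0\<close> and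
  appending \<open>a\<close> to a sequence with code \<open>c\<close> gives the code \<open>1 + \<langle>c, a\<rangle>\<close>, so that coding is a
  bijection between finite sequences and numbers.\<close>

definition Bar :: tm where
  "Bar = lam (0, T1) (lam0 0 (Rec0 \<cdot>
     lam0 2 (lam0 3 (Succ \<cdot> (CPair \<cdot> n3 \<cdot> (V 0 T1 \<cdot> n2)))) \<cdot> Zero \<cdot> n0))"

text \<open>\<open>tuple [c\<^sub>1, \<dots>, c\<^sub>k]\<close> is \<open>c\<^sub>1\<close> for \<open>k = 1\<close> and the iterated pair otherwise.\<close>

fun tuple :: "tm list \<Rightarrow> tm" where
  "tuple [] = Zero"
| "tuple [c] = c"
| "tuple (c # d # cs) = CPair \<cdot> c \<cdot> tuple (d # cs)"


section \<open>Comprehension functionals\<close>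

fun alternating :: "bool \<Rightarrow> var list \<Rightarrow> fm \<Rightarrow> fm" where
  "alternating b [] \<phi> = \<phi>"
| "alternating True (v # vs) \<phi> = Exists v (alternating False vs \<phi>)"
| "alternating False (v # vs) \<phi> = Forall v (alternating True vs \<phi>)"

text \<open>\<open>sigma1 k\<close> is the formula
  \<open>\<exists>g\<^sub>1 \<forall>g\<^sub>2 \<dots> Q g\<^sub>k Q' n. f \<langle>Bar g\<^sub>1 n, \<dots>, Bar g\<^sub>k n\<rangle> = 0\<close>, where \<open>g\<^sub>1, \<dots>, g\<^sub>k\<close> are the type 1
  variables with index below \<open>k\<close> and the free variable \<open>f\<close> is the one with index \<open>k\<close>.\<close>

definition sigma1 :: "nat \<Rightarrow> fm" where
  "sigma1 k = alternating True (map (\<lambda>i. (i, T1)) [0..<k] @ [(0, N)])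
     (V k T1 \<cdot> tuple (map (\<lambda>i. Bar \<cdot> V i T1 \<cdot> n0) [0..<k]) \<^bold>= Zero)"

definition S2 :: "nat \<Rightarrow> fm" where
  "S2 k = Exists (0, T2) (Forall (k, T1)
     ((V 0 T2 \<cdot> V k T1 \<^bold>= Zero \<^bold>\<or> V 0 T2 \<cdot> V k T1 \<^bold>= One) \<^bold>\<and>
      (V 0 T2 \<cdot> V k T1 \<^bold>= Zero \<^bold>\<longleftrightarrow> sigma1 k)))"

definition Pi1_CA0_omega :: "nat \<Rightarrow> fm set" where
  "Pi1_CA0_omega k = RCA0_omega \<union> {S2 k}"

definition Z2_omega :: "fm set" where
  "Z2_omega = (\<Union>k\<in>{1..}. Pi1_CA0_omega k)"


section \<open>Real numbers\<close>

text \<open>The number \<open>\<langle>a, \<langle>b, d\<rangle>\<rangle>\<close> codes the rational \<open>(a - b)/(d + 1)\<close>; every number is such a code.\<close>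

abbreviation posp :: "tm \<Rightarrow> tm" where "posp q \<equiv> Fst \<cdot> q"
abbreviation negp :: "tm \<Rightarrow> tm" where "negp q \<equiv> Fst \<cdot> (Snd \<cdot> q)"
abbreviation den :: "tm \<Rightarrow> tm" where "den q \<equiv> Succ \<cdot> (Snd \<cdot> (Snd \<cdot> q))"

text \<open>\<open>q - r = (cross q r - cross r q) / (den q * den r)\<close>\<close>

definition cross :: "tm \<Rightarrow> tm \<Rightarrow> tm" where
  "cross q r = Add \<cdot> (Mul \<cdot> posp q \<cdot> den r) \<cdot> (Mul \<cdot> negp r \<cdot> den q)"

definition le_tm :: "tm \<Rightarrow> tm \<Rightarrow> fm" where
  "le_tm s t = (Monus \<cdot> s \<cdot> t \<^bold>= Zero)"

text \<open>\<open>q - r < 2\<^sup>-\<^sup>n\<close> and \<open>q - r \<le> 2 \<cdot> 2\<^sup>-\<^sup>n\<close> for rational codes \<open>q\<close>, \<open>r\<close>\<close>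

definition diff_less :: "tm \<Rightarrow> tm \<Rightarrow> tm \<Rightarrow> fm" where
  "diff_less q r n = le_tm (Succ \<cdot> (Mul \<cdot> cross q r \<cdot> (Exp2 \<cdot> n)))
     (Add \<cdot> (Mul \<cdot> cross r q \<cdot> (Exp2 \<cdot> n)) \<cdot> (Mul \<cdot> den q \<cdot> den r))"

definition diff_le2 :: "tm \<Rightarrow> tm \<Rightarrow> tm \<Rightarrow> fm" where
  "diff_le2 q r n = le_tm (Mul \<cdot> cross q r \<cdot> (Exp2 \<cdot> n))
     (Add \<cdot> (Mul \<cdot> cross r q \<cdot> (Exp2 \<cdot> n)) \<cdot> (Mul \<cdot> (Succ \<cdot> One) \<cdot> (Mul \<cdot> den q \<cdot> den r)))"

text \<open>The following formulas bind the type 0 variables \<open>n0\<close> and \<open>n1\<close>; they are only applied to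
  terms \<open>x\<close>, \<open>y\<close> without free type 0 variables. A real is an \<open>x\<close> of type 1 with
  \<open>\<bar>x n - x (n + i)\<bar> < 2\<^sup>-\<^sup>n\<close> for all \<open>n, i\<close>.\<close>

definition is_real :: "tm \<Rightarrow> fm" where
  "is_real x = Forall (0, N) (Forall (1, N)
     (diff_less (x \<cdot> n0) (x \<cdot> (Add \<cdot> n0 \<cdot> n1)) n0 \<^bold>\<and> diff_less (x \<cdot> (Add \<cdot> n0 \<cdot> n1)) (x \<cdot> n0) n0))"

definition eq_real :: "tm \<Rightarrow> tm \<Rightarrow> fm" where
  "eq_real x y = Forall (0, N) (diff_le2 (x \<cdot> n0) (y \<cdot> n0) n0 \<^bold>\<and> diff_le2 (y \<cdot> n0) (x \<cdot> n0) n0)"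

definition le_real :: "tm \<Rightarrow> tm \<Rightarrow> fm" where
  "le_real x y = Forall (0, N) (diff_le2 (x \<cdot> n0) (y \<cdot> n0) n0)"

definition real_zero :: tm where "real_zero = Kc N N \<cdot> (CPair \<cdot> Zero \<cdot> (CPair \<cdot> Zero \<cdot> Zero))"
definition real_one :: tm where "real_one = Kc N N \<cdot> (CPair \<cdot> One \<cdot> (CPair \<cdot> Zero \<cdot> Zero))"

definition in_unit_interval :: "tm \<Rightarrow> fm" where
  "in_unit_interval x = (is_real x \<^bold>\<and> le_real real_zero x \<^bold>\<and> le_real x real_one)"

text \<open>\<open>Y : [0,1] \<rightarrow> \<nat>\<close> is a type 2 object respecting equality of reals on \<open>[0,1]\<close>; its values on
  other elements of type 1 play no role.\<close>

definition fun_unit_interval_nat :: "tm \<Rightarrow> fm" where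
  "fun_unit_interval_nat Y = Forall (0, T1) (Forall (1, T1)
     (in_unit_interval (V 0 T1) \<^bold>\<and> in_unit_interval (V 1 T1) \<^bold>\<and> eq_real (V 0 T1) (V 1 T1) \<^bold>\<longrightarrow>
      Y \<cdot> V 0 T1 \<^bold>= Y \<cdot> V 1 T1))"

definition NIN :: fm where
  "NIN = Forall (0, T2) (fun_unit_interval_nat (V 0 T2) \<^bold>\<longrightarrow>
     Exists (0, T1) (Exists (1, T1)
       (in_unit_interval (V 0 T1) \<^bold>\<and> in_unit_interval (V 1 T1) \<^bold>\<and>
        (\<^bold>\<not> eq_real (V 0 T1) (V 1 T1)) \<^bold>\<and> V 0 T2 \<cdot> V 0 T1 \<^bold>= V 0 T2 \<cdot> V 1 T1)))"

end

theory Submission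
  imports Defs Complex_Main "HOL-Library.Countable"
begin

text \<open>The countermodel consists of the hereditarily extensional operations over a partial combinatory
  algebra on a countable set of codes. Application is built in transfinite stages, and besides
  the combinators and recursion it has three kinds of instructions. Oracles provide Skolem functions and
  truth for second-order arithmetic over all of \<open>\<nat>\<^sup>\<nat>\<close>; hence the total functions with a code form an
  elementary substructure, on which every \<open>S\<^sub>k\<^sup>2\<close> has a code. The codes of total functions are
  well-ordered by the stage at which they become total, an order that is settled for a code as
  soon as it becomes total; so a further instruction can search for the first total code on which a
  given type 2 object vanishes, and as the answer depends only on the extension of that object,
  this yields quantifier-free choice. Finally, another instruction maps a real to the number of
  the first code of a canonical representation of this real, which is an injection of the reals
  of the model into the natural numbers.\<close>

section \<open>The application graph\<close>

primrec tri :: "nat \<Rightarrow> nat" where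
  "tri 0 = 0"
| "tri (Suc n) = tri n + Suc n"

definition cpair :: "nat \<Rightarrow> nat \<Rightarrow> nat" where
  "cpair m n = tri (m + n) + n"

primrec root :: "nat \<Rightarrow> nat" where
  "root 0 = 0"
| "root (Suc n) = root n + (1 - (tri (Suc (root n)) - Suc n))"

definition csnd :: "nat \<Rightarrow> nat" where "csnd n = n - tri (root n)"
definition cfst :: "nat \<Rightarrow> nat" where "cfst n = root n - csnd n"

primrec bar :: "(nat \<Rightarrow> nat) \<Rightarrow> nat \<Rightarrow> nat" where
  "bar g 0 = 0"
| "bar g (Suc n) = Suc (cpair (bar g n) (g n))"

fun ctuple :: "nat list \<Rightarrow> nat" where
  "ctuple [] = 0"
| "ctuple [c] = c"
| "ctuple (c # d # cs) = cpair c (ctuple (d # cs))"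

text \<open>In \<open>matrix\<close> and \<open>proj_true\<close> the head of the list is the parameter \<open>f\<close> of \<^const>\<open>sigma1\<close>, and its
  tail consists of \<open>g\<^sub>1, g\<^sub>2, \<dots>\<close>; the number counts the remaining function quantifiers.\<close>

definition matrix :: "(nat \<Rightarrow> nat) list \<Rightarrow> nat \<Rightarrow> bool" where
  "matrix fs n \<longleftrightarrow> hd fs (ctuple (map (\<lambda>g. bar g n) (tl fs))) = 0"

fun proj_true :: "bool \<Rightarrow> nat \<Rightarrow> (nat \<Rightarrow> nat) list \<Rightarrow> bool" where
  "proj_true True 0 fs = (\<exists>n. matrix fs n)"
| "proj_true False 0 fs = (\<forall>n. matrix fs n)"
| "proj_true True (Suc m) fs = (\<exists>g. proj_true False m (fs @ [g]))"
| "proj_true False (Suc m) fs = (\<forall>g. proj_true True m (fs @ [g]))"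

section \<open>Representations of real numbers\<close>

definition rat_of :: "nat \<Rightarrow> real" where
  "rat_of q = (real (cfst q) - real (cfst (csnd q))) / real (Suc (csnd (csnd q)))"

definition real_code :: "(nat \<Rightarrow> nat) \<Rightarrow> bool" where
  "real_code x \<longleftrightarrow> (\<forall>n i. \<bar>rat_of (x n) - rat_of (x (n + i))\<bar> < 1 / 2 ^ n)"

definition real_of_code :: "(nat \<Rightarrow> nat) \<Rightarrow> real" where
  "real_of_code x = lim (\<lambda>n. rat_of (x n))"

text \<open>Fast convergence makes the sequence Cauchy. Letting \<open>i\<close> grow in the
  defining inequality then replaces \<open>x (n + i)\<close> by the limit, at the price of turning
  the strict bound into a weak one.\<close>

lemma real_code_bound:
  assumes "real_code x"
  shows "\<bar>rat_of (x n) - real_of_code x\<bar> \<le> 1 / 2 ^ n"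
proof -
  let ?s = "\<lambda>n. rat_of (x n)"
  have "Cauchy ?s"
  proof (rule metric_CauchyI)
    fix e :: real assume "e > 0"
    then obtain M where M: "(1/2) ^ M < e / 2"
      using real_arch_pow_inv[of "e/2" "1/2"] by auto
    have "dist (?s m) (?s n) < e" if "m \<ge> M" "n \<ge> M" for m n
    proof -
      have "\<bar>?s M - ?s m\<bar> < 1 / 2 ^ M" "\<bar>?s M - ?s n\<bar> < 1 / 2 ^ M"
        using assms that by (metis real_code_def le_add_diff_inverse)+
      then show ?thesis using M by (simp add: dist_real_def power_one_over)
    qed
    then show "\<exists>M. \<forall>m\<ge>M. \<forall>n\<ge>M. dist (?s m) (?s n) < e" by blast
  qed
  then have "?s \<longlonglongrightarrow> real_of_code x"
    unfolding real_of_code_def by (simp add: Cauchy_convergent_iff convergent_LIMSEQ_iff)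
  then have "(\<lambda>i. \<bar>?s n - ?s (i + n)\<bar>) \<longlonglongrightarrow> \<bar>?s n - real_of_code x\<bar>"
    by (intro tendsto_intros LIMSEQ_ignore_initial_segment)
  then show ?thesis
    by (rule LIMSEQ_le_const2)
      (use assms in \<open>auto simp: real_code_def add.commute[of _ n] intro!: exI[of _ 0] less_imp_le\<close>)
qed

text \<open>This is what \<open>eq_real\<close> expresses. Two errors of at most
  \<open>1 / 2 ^ n\<close> add up to the tolerance \<open>2 / 2 ^ n\<close>; conversely that
  tolerance and the two errors bound the distance of the limits by \<open>4 / 2 ^ n\<close>, which
  tends to 0.\<close>

lemma real_code_eq_iff:
  assumes x: "real_code x" and y: "real_code y"
  shows "real_of_code x = real_of_code y \<longleftrightarrow> (\<forall>n. \<bar>rat_of (x n) - rat_of (y n)\<bar> \<le> 2 / 2 ^ n)"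
proof
  assume eq: "real_of_code x = real_of_code y"
  show "\<forall>n. \<bar>rat_of (x n) - rat_of (y n)\<bar> \<le> 2 / 2 ^ n"
  proof
    fix n
    show "\<bar>rat_of (x n) - rat_of (y n)\<bar> \<le> 2 / 2 ^ n"
      using real_code_bound[OF x, of n] real_code_bound[OF y, of n] eq by (simp add: abs_le_iff)
  qed
next
  assume close: "\<forall>n. \<bar>rat_of (x n) - rat_of (y n)\<bar> \<le> 2 / 2 ^ n"
  have bound: "\<bar>real_of_code x - real_of_code y\<bar> \<le> 4 * (1/2) ^ n" for n
    using real_code_bound[OF x, of n] real_code_bound[OF y, of n] close[rule_format, of n]
    by (simp add: power_one_over)
  have "(\<lambda>n. 4 * (1/2) ^ n :: real) \<longlonglongrightarrow> 4 * 0"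
    by (intro tendsto_intros LIMSEQ_power_zero) auto
  then have "\<bar>real_of_code x - real_of_code y\<bar> \<le> 4 * 0"
    by (rule LIMSEQ_le_const) (use bound in auto)
  then show "real_of_code x = real_of_code y" by simp
qed

text \<open>In \<open>Skolem b m\<close> the boolean tells whether the outermost quantifier is
  existential or universal, so that a witness or a counterexample is wanted; \<open>m\<close> counts
  the function quantifiers after it.\<close>

datatype label = Skolem bool nat | Truth nat | Canon

fun oracle_fun :: "label \<Rightarrow> (nat \<Rightarrow> nat) list \<Rightarrow> nat \<Rightarrow> nat" where
  "oracle_fun (Skolem True m) fs = (SOME g. proj_true False m (fs @ [g]))"
| "oracle_fun (Skolem False m) fs = (SOME g. \<not> proj_true True m (fs @ [g]))"
| "oracle_fun (Truth k) fs = (\<lambda>_. if proj_true True k fs then 0 else 1)"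
| "oracle_fun Canon fs = (SOME z. real_code z \<and> real_of_code z = real_of_code (hd fs))"

text \<open>The predicate under \<open>SOME\<close> mentions the argument only through the real it
  represents, so equal reals get the same choice; the choice represents that real again, so distinct
  reals get distinct ones.\<close>

lemma canon_eq_iff:
  assumes "real_code x" "real_code y"
  shows "oracle_fun Canon [x] = oracle_fun Canon [y] \<longleftrightarrow> real_of_code x = real_of_code y"
proof -
  have canon: "real_of_code (oracle_fun Canon [z]) = real_of_code z" if "real_code z" for z
    using someI[of "\<lambda>w. real_code w \<and> real_of_code w = real_of_code z" z] that by simp
  then show ?thesis using assms by (metis list.sel(1) oracle_fun.simps(4))
qed

text \<open>\<open>Orc l cs\<close> is a type 1 oracle with the total codes \<open>cs\<close> as parameters, and \<open>Dec l\<close> a type 2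
  oracle. \<open>CK1\<close>, \<open>CS1\<close>, \<open>CS2\<close>, \<open>CR1\<close> and \<open>CR2\<close> are partial applications.\<close>

datatype code =
    Num nat
  | CK | CK1 code
  | CS | CS1 code | CS2 code code
  | CSucc
  | CR | CR1 code | CR2 code code
  | Orc label "code list"
  | Dec label
  | Index
  | Sel
  | SelN

instance label :: countable by countable_datatype
instance code :: countable by countable_datatype

type_synonym graph = "(code \<times> code \<times> code) set"

section \<open>Graphs of partial application and their total codes\<close>

definition tot :: "graph \<Rightarrow> code set" where
  "tot A = {c. \<forall>n. \<exists>m. (c, Num n, Num m) \<in> A}"

definition fn :: "graph \<Rightarrow> code \<Rightarrow> nat \<Rightarrow> nat" where
  "fn A c n = (THE m. (c, Num n, Num m) \<in> A)"

definition functional :: "graph \<Rightarrow> bool" where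
  "functional A \<longleftrightarrow> (\<forall>a b c d. (a, b, c) \<in> A \<longrightarrow> (a, b, d) \<in> A \<longrightarrow> c = d)"

lemma functionalD: "functional A \<Longrightarrow> (a, b, c) \<in> A \<Longrightarrow> (a, b, d) \<in> A \<Longrightarrow> c = d"
  unfolding functional_def by blast

lemma tot_mono: "A \<subseteq> B \<Longrightarrow> tot A \<subseteq> tot B"
  unfolding tot_def by blast

lemma fn_eq: "functional A \<Longrightarrow> (c, Num n, Num m) \<in> A \<Longrightarrow> fn A c n = m"
  unfolding fn_def by (blast dest: functionalD)

lemma tot_fn: "functional A \<Longrightarrow> c \<in> tot A \<Longrightarrow> (c, Num n, Num (fn A c n)) \<in> A"
  unfolding tot_def using fn_eq by fastforce

text \<open>A total code already has all its values, and functionality of the larger graph excludes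
  others. Hence an oracle that reads \<open>fn\<close> of a total code never has to revise its
  answer.\<close>

lemma fn_mono:
  assumes "A \<subseteq> B" "functional B" "c \<in> tot A"
  shows "fn B c = fn A c"
proof
  fix n
  have "functional A" using assms(1,2) unfolding functional_def by blast
  with assms show "fn B c n = fn A c n" by (blast intro: fn_eq tot_fn)
qed

text \<open>Stages are indexed by a wellorder too long to inject into the set of possible facts
  \<open>a \<cdot> b = c\<close>, which forces the construction to become stationary.\<close>

typedef stage = "UNIV :: graph set" ..

definition stage_rel :: "graph rel" where
  "stage_rel = (SOME r. well_order_on UNIV r)"

lemma stage_rel: "well_order_on UNIV stage_rel"
  unfolding stage_rel_def by (rule someI_ex) (rule well_order_on)

instantiation stage :: wellorder
begin

definition less_eq_stage :: "stage \<Rightarrow> stage \<Rightarrow> bool" where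
  "i \<le> j \<longleftrightarrow> (Rep_stage i, Rep_stage j) \<in> stage_rel"

definition less_stage :: "stage \<Rightarrow> stage \<Rightarrow> bool" where
  "i < j \<longleftrightarrow> i \<le> j \<and> \<not> j \<le> (i :: stage)"

instance
proof
  have lin: "refl stage_rel" "trans stage_rel" "antisym stage_rel" "total stage_rel"
    and wf: "wf (stage_rel - Id)"
    using stage_rel by (auto simp: well_order_on_def linear_order_on_def partial_order_on_def
        preorder_on_def refl_on_def)
  fix i j k :: stage
  show "(i < j) = (i \<le> j \<and> \<not> j \<le> i)" by (rule less_stage_def)
  show "i \<le> i" using lin(1) by (simp add: less_eq_stage_def refl_onD)
  show "i \<le> j \<Longrightarrow> j \<le> k \<Longrightarrow> i \<le> k" using lin(2) by (auto simp: less_eq_stage_def dest: transD)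
  show anti: "i \<le> j \<Longrightarrow> j \<le> i \<Longrightarrow> i = j" for i j :: stage
    using lin(3) by (auto simp: less_eq_stage_def Rep_stage_inject dest: antisymD)
  show "i \<le> j \<or> j \<le> i" using lin(1,4)
    by (cases "i = j") (auto simp: less_eq_stage_def total_on_def Rep_stage_inject dest: refl_onD)
  fix P :: "stage \<Rightarrow> bool" and a :: stage
  assume IH: "\<And>x. (\<And>y. y < x \<Longrightarrow> P y) \<Longrightarrow> P x"
  have "wf (inv_image (stage_rel - Id) Rep_stage)" using wf by (rule wf_inv_image)
  then show "P a"
  proof (induction a rule: wf_induct_rule)
    case (less x)
    show ?case
    proof (rule IH)
      fix y assume y: "y < x"
      then have "y \<noteq> x" by (auto simp: less_stage_def)
      with y show "P y"
        by (intro less) (auto simp: in_inv_image less_stage_def less_eq_stage_def Rep_stage_inject)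
    qed
  qed
qed

end

text \<open>Total codes are ordered by the stage at which they become total, ties being broken by
  \<open>to_nat\<close>. At stage \<open>j\<close> the position in this order of the codes total so far is final.\<close>

definition before :: "(stage \<Rightarrow> graph) \<Rightarrow> stage \<Rightarrow> code \<Rightarrow> code \<Rightarrow> bool" where
  "before H j c d \<longleftrightarrow> (\<exists>k\<le>j. c \<in> tot (H k) \<and> d \<notin> tot (H k)) \<or>
     ((\<forall>k\<le>j. c \<in> tot (H k) \<longleftrightarrow> d \<in> tot (H k)) \<and> to_nat c < to_nat d)"

text \<open>The rules \<open>Index\<close> and \<open>Sel\<close> are not monotone in \<open>H\<close>, which is why this is iterated along stages
  instead of being a single inductive definition of the graph.\<close>

inductive step :: "(stage \<Rightarrow> graph) \<Rightarrow> stage \<Rightarrow> code \<Rightarrow> code \<Rightarrow> code \<Rightarrow> bool" for H j where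
  CK: "step H j CK a (CK1 a)"
| CK1: "step H j (CK1 a) b a"
| CS: "step H j CS a (CS1 a)"
| CS1: "step H j (CS1 a) b (CS2 a b)"
| CS2: "\<lbrakk>(a, c, u) \<in> H j; (b, c, v) \<in> H j; (u, v, w) \<in> H j\<rbrakk> \<Longrightarrow> step H j (CS2 a b) c w"
| CSucc: "step H j CSucc (Num n) (Num (Suc n))"
| CR: "step H j CR a (CR1 a)"
| CR1: "step H j (CR1 a) b (CR2 a b)"
| CR2_0: "step H j (CR2 a b) (Num 0) b"
| CR2_Suc: "\<lbrakk>(CR2 a b, Num n, u) \<in> H j; (a, Num n, v) \<in> H j; (v, u, w) \<in> H j\<rbrakk> \<Longrightarrow>
    step H j (CR2 a b) (Num (Suc n)) w"
| Orc: "set cs \<subseteq> tot (H j) \<Longrightarrow>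
    step H j (Orc l cs) (Num n) (Num (oracle_fun l (map (fn (H j)) cs) n))"
| Dec: "c \<in> tot (H j) \<Longrightarrow> step H j (Dec l) c (Num (oracle_fun l [fn (H j) c] 0))"
| Index: "\<lbrakk>c \<in> tot (H j); d \<in> tot (H j); fn (H j) d = oracle_fun Canon [fn (H j) c];
    \<And>e. e \<in> tot (H j) \<Longrightarrow> before H j e d \<Longrightarrow> fn (H j) e \<noteq> fn (H j) d\<rbrakk> \<Longrightarrow>
    step H j Index c (Num (to_nat d))"
| Sel: "\<lbrakk>d \<in> tot (H j); (c, d, Num 0) \<in> H j;
    \<And>e. e \<in> tot (H j) \<Longrightarrow> before H j e d \<Longrightarrow> \<exists>m. (c, e, Num (Suc m)) \<in> H j\<rbrakk> \<Longrightarrow>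
    step H j Sel c d"
| SelN: "\<lbrakk>(c, Num n, Num 0) \<in> H j; \<And>i. i < n \<Longrightarrow> \<exists>m. (c, Num i, Num (Suc m)) \<in> H j\<rbrakk> \<Longrightarrow>
    step H j SelN c (Num n)"

section \<open>The iteration along stages\<close>

lemma before_cong:
  assumes "\<And>k. k \<le> j \<Longrightarrow> H k = H' k"
  shows "before H j c d = before H' j c d"
  unfolding before_def using assms by auto

text \<open>A step at \<open>j\<close> inspects the history only up to \<open>j\<close>, which is
  what justifies the recursion defining \<open>graph_at\<close>.\<close>

lemma step_cong_imp:
  assumes "step H j a b c" and "\<And>k. k \<le> j \<Longrightarrow> H k = H' k"
  shows "step H' j a b c"
proof -
  have [simp]: "H j = H' j" using assms(2) by simp
  have [simp]: "before H j = before H' j" by (intro ext before_cong assms(2))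
  show ?thesis using assms(1) by cases (auto intro: step.intros)
qed

text \<open>The graph at \<open>i\<close> collects the conclusions drawn at all strictly earlier
  stages. Monotonicity is thereby built in, and limit stages need no clause of their own.\<close>

definition graph_at :: "stage \<Rightarrow> graph" where
  "graph_at = wfrec {(i, j). i < j} (\<lambda>H i. {(a, b, c). \<exists>j<i. step H j a b c})"

lemma graph_at: "(a, b, c) \<in> graph_at i \<longleftrightarrow> (\<exists>j<i. step graph_at j a b c)"
proof -
  let ?r = "{(i, j). i < j} :: stage rel"
  have "graph_at i = {(a, b, c). \<exists>j<i. step (cut graph_at ?r i) j a b c}"
    unfolding graph_at_def by (subst wfrec[OF wf]) simp
  moreover have "step (cut graph_at ?r i) j a b c \<longleftrightarrow> step graph_at j a b c" if "j < i" for j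
    using that by (intro iffI; elim step_cong_imp) (auto simp: cut_def)
  ultimately show ?thesis by auto
qed

lemma graph_at_mono: "i \<le> j \<Longrightarrow> graph_at i \<subseteq> graph_at j"
  by (auto simp: graph_at) (meson order_less_le_trans)

lemma tot_at_mono: "i \<le> j \<Longrightarrow> c \<in> tot (graph_at i) \<Longrightarrow> c \<in> tot (graph_at j)"
  using tot_mono[OF graph_at_mono] by blast

text \<open>From \<open>i\<close> on \<open>c\<close> is total, so no later stage can make
  \<open>d\<close> total ahead of it. If both have agreed in totality up to \<open>i\<close>, then
  both are total at \<open>i\<close> and stay so.\<close>

lemma before_stable:
  assumes "i \<le> j" "c \<in> tot (graph_at i)"
  shows "before graph_at j d c \<longleftrightarrow> before graph_at i d c"
proof -
  have c: "c \<in> tot (graph_at k)" if "i \<le> k" for k using that assms(2) tot_at_mono by blast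
  have "(\<exists>k\<le>j. d \<in> tot (graph_at k) \<and> c \<notin> tot (graph_at k)) \<longleftrightarrow>
      (\<exists>k\<le>i. d \<in> tot (graph_at k) \<and> c \<notin> tot (graph_at k))"
  proof (intro iffI; elim exE conjE)
    fix k assume "k \<le> j" "d \<in> tot (graph_at k)" "c \<notin> tot (graph_at k)"
    then show "\<exists>k\<le>i. d \<in> tot (graph_at k) \<and> c \<notin> tot (graph_at k)"
      using c[of k] linear[of k i] by blast
  next
    fix k assume "k \<le> i" "d \<in> tot (graph_at k)" "c \<notin> tot (graph_at k)"
    then show "\<exists>k\<le>j. d \<in> tot (graph_at k) \<and> c \<notin> tot (graph_at k)"
      using order_trans[OF _ assms(1)] by blast
  qed
  moreover have "(\<forall>k\<le>j. d \<in> tot (graph_at k) \<longleftrightarrow> c \<in> tot (graph_at k)) \<longleftrightarrow>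
      (\<forall>k\<le>i. d \<in> tot (graph_at k) \<longleftrightarrow> c \<in> tot (graph_at k))"
  proof (rule iffI; intro allI impI)
    fix k assume "\<forall>k\<le>j. d \<in> tot (graph_at k) \<longleftrightarrow> c \<in> tot (graph_at k)" "k \<le> i"
    then show "d \<in> tot (graph_at k) \<longleftrightarrow> c \<in> tot (graph_at k)"
      using order_trans[OF _ assms(1)] by blast
  next
    fix k assume eq: "\<forall>k\<le>i. d \<in> tot (graph_at k) \<longleftrightarrow> c \<in> tot (graph_at k)" and "k \<le> j"
    show "d \<in> tot (graph_at k) \<longleftrightarrow> c \<in> tot (graph_at k)"
    proof (cases "k \<le> i")
      case True
      then show ?thesis using eq by blast
    next
      case False
      then have "i \<le> k" by simp
      moreover have "d \<in> tot (graph_at i)" using eq assms(2) by blast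
      ultimately show ?thesis using c tot_at_mono by blast
    qed
  qed
  ultimately show ?thesis unfolding before_def by simp
qed

lemma before_tot: "before graph_at j d c \<Longrightarrow> c \<in> tot (graph_at i) \<Longrightarrow> i \<le> j \<Longrightarrow> d \<in> tot (graph_at i)"
  unfolding before_def using tot_at_mono[of _ i] tot_at_mono[of i] linear[of _ i] by blast

lemma before_total:
  "c = d \<or> before graph_at j c d \<or> before graph_at j d c"
proof (cases "\<forall>k\<le>j. c \<in> tot (graph_at k) \<longleftrightarrow> d \<in> tot (graph_at k)")
  case True
  then show ?thesis unfolding before_def using linorder_neqE_nat[of "to_nat c" "to_nat d"] by auto
next
  case False
  then show ?thesis unfolding before_def by blast
qed

text \<open>A lexicographic minimum: first the least stage at which some code with \<open>P\<close>
  is total, then the least \<open>to_nat\<close> among the codes with \<open>P\<close> total at that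
  stage.\<close>

lemma first_exists:
  assumes "P d" "d \<in> tot (graph_at i)"
  shows "\<exists>e\<in>tot (graph_at i). P e \<and> (\<forall>c\<in>tot (graph_at i). before graph_at i c e \<longrightarrow> \<not> P c)"
proof -
  let ?Q = "\<lambda>k. \<exists>c. P c \<and> c \<in> tot (graph_at k)"
  define k where "k = (LEAST k. ?Q k)"
  have Q: "?Q i" using assms by blast
  have k: "?Q k" "k \<le> i" unfolding k_def using LeastI[of ?Q, OF Q] Least_le[of ?Q, OF Q] by auto
  have least: "c \<notin> tot (graph_at l)" if "P c" "l < k" for c l
    using that not_less_Least[of l ?Q] unfolding k_def by blast
  obtain e where e: "P e" "e \<in> tot (graph_at k)"
    and min: "\<And>c. P c \<Longrightarrow> c \<in> tot (graph_at k) \<Longrightarrow> to_nat e \<le> to_nat c"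
    using ex_has_least_nat[of "\<lambda>c. P c \<and> c \<in> tot (graph_at k)" _ to_nat] k(1) by blast
  have "\<not> P c" if "before graph_at i c e" for c
  proof
    assume "P c"
    \<comment> \<open>The comparison is moved back to the least stage \<open>k\<close>. There
      \<open>c\<close> cannot have become total earlier than \<open>e\<close>, by the choice of
      \<open>k\<close>, and cannot win the tie, by the choice of \<open>e\<close>.\<close>
    have "before graph_at k c e" using that before_stable[OF k(2) e(2)] by simp
    moreover have "c \<in> tot (graph_at k)" by (rule before_tot[OF calculation e(2)]) simp
    ultimately show False unfolding before_def
      using min[OF \<open>P c\<close>] least[OF \<open>P c\<close>] e(2) by (auto simp: order_le_less)
  qed
  then show ?thesis using e tot_at_mono[OF k(2)] by blast
qed

text \<open>The critical rules \<open>Index\<close> and \<open>Sel\<close> speak about every code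
  before \<open>d\<close>. As \<open>d\<close> is total at \<open>i\<close>, its predecessors are
  total at \<open>i\<close> too and their order is settled, so no new competitor can appear by stage
  \<open>j\<close>.\<close>

lemma step_mono:
  assumes "step graph_at i a b c" "i \<le> j" "functional (graph_at j)"
  shows "step graph_at j a b c"
proof -
  have sub: "x \<in> graph_at i \<Longrightarrow> x \<in> graph_at j" for x using graph_at_mono assms(2) by blast
  have tot: "x \<in> tot (graph_at i) \<Longrightarrow> x \<in> tot (graph_at j)" for x using tot_at_mono assms(2) by blast
  have fn: "x \<in> tot (graph_at i) \<Longrightarrow> fn (graph_at j) x = fn (graph_at i) x" for x
    using fn_mono[OF graph_at_mono assms(3)] assms(2) by blast
  have bef: "e \<in> tot (graph_at i) \<and> before graph_at i e d"
    if "before graph_at j e d" "d \<in> tot (graph_at i)" for d e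
    using that before_stable before_tot assms(2) by blast
  show ?thesis using assms(1)
  proof cases
    case (Orc cs l n)
    then have "map (fn (graph_at i)) cs = map (fn (graph_at j)) cs" using fn by auto
    moreover have "set cs \<subseteq> tot (graph_at j)" using Orc tot by blast
    ultimately show ?thesis using Orc step.Orc by metis
  next
    case (Dec l)
    then show ?thesis using step.Dec[of b graph_at j l] tot fn by simp
  next
    case (Index d)
    have "step graph_at j Index b (Num (to_nat d))"
      by (rule step.Index) (use Index tot fn bef in auto)
    then show ?thesis using Index by simp
  next
    case Sel
    have "step graph_at j Sel b c"
      by (rule step.Sel) (use Sel tot sub bef in blast)+
    then show ?thesis using Sel by simp
  next
    case (SelN n)
    have "step graph_at j SelN b (Num n)"
      by (rule step.SelN) (use SelN sub in blast)+
    then show ?thesis using SelN by simp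
  qed (auto intro: step.intros sub)
qed

text \<open>For \<open>Index\<close> and \<open>Sel\<close> two different results would be
  comparable by \<open>before\<close>, and the earlier one would contradict the minimality of the
  later one. For \<open>SelN\<close> the same is said of the least zero.\<close>

lemma step_functional:
  assumes "functional (graph_at j)" "step graph_at j a b c" "step graph_at j a b d"
  shows "c = d"
  using assms(2)
proof cases
  case (CS2 a' u b' v)
  from assms(3) CS2 obtain u' v' where "(a', b, u') \<in> graph_at j"
    "(b', b, v') \<in> graph_at j" "(u', v', d) \<in> graph_at j" by (auto elim: step.cases)
  with CS2 show ?thesis using functionalD[OF assms(1)] by blast
next
  case (CR2_Suc a' b' n u v)
  from assms(3) CR2_Suc obtain u' v' where "(CR2 a' b', Num n, u') \<in> graph_at j"
    "(a', Num n, v') \<in> graph_at j" "(v', u', d) \<in> graph_at j" by (auto elim: step.cases)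
  with CR2_Suc show ?thesis using functionalD[OF assms(1)] by blast
next
  case (Index e)
  from assms(3) Index obtain e' where e': "d = Num (to_nat e')" "e' \<in> tot (graph_at j)"
    "fn (graph_at j) e' = oracle_fun Canon [fn (graph_at j) b]"
    "\<And>c. c \<in> tot (graph_at j) \<Longrightarrow> before graph_at j c e' \<Longrightarrow> fn (graph_at j) c \<noteq> fn (graph_at j) e'"
    by (auto elim: step.cases)
  then have "e = e'" using Index before_total[of e e' j] by auto
  then show ?thesis using Index e' by simp
next
  case Sel
  from assms(3) Sel have d: "d \<in> tot (graph_at j)" "(b, d, Num 0) \<in> graph_at j"
    "\<And>e. e \<in> tot (graph_at j) \<Longrightarrow> before graph_at j e d \<Longrightarrow> \<exists>m. (b, e, Num (Suc m)) \<in> graph_at j"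
    by (auto elim: step.cases)
  show ?thesis
    using before_total[of c d j] d Sel functionalD[OF assms(1), of b _ "Num 0" "Num (Suc _)"] by blast
next
  case (SelN n)
  from assms(3) SelN obtain n' where n': "d = Num n'" "(b, Num n', Num 0) \<in> graph_at j"
    "\<And>i. i < n' \<Longrightarrow> \<exists>m. (b, Num i, Num (Suc m)) \<in> graph_at j"
    by (auto elim: step.cases)
  then have "n = n'"
    using SelN functionalD[OF assms(1), of b _ "Num 0" "Num (Suc _)"] linorder_neqE_nat[of n n'] by blast
  then show ?thesis using SelN n' by simp
qed (use assms(3) in \<open>auto elim: step.cases\<close>)

text \<open>Facts from stages \<open>j\<close> and \<open>k\<close> are compared at the larger of
  the two. It lies below \<open>i\<close>, so the induction hypothesis supplies the functionality
  that \<open>step_mono\<close> asks for.\<close>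

lemma functional_graph_at: "functional (graph_at i)"
proof (induction i rule: less_induct)
  case (less i)
  show ?case unfolding functional_def
  proof (intro allI impI)
    fix a b c d
    assume "(a, b, c) \<in> graph_at i" "(a, b, d) \<in> graph_at i"
    then obtain j k where j: "j < i" "step graph_at j a b c" and k: "k < i" "step graph_at k a b d"
      by (auto simp: graph_at)
    define m where "m = max j k"
    have fm: "functional (graph_at m)" using less j(1) k(1) by (simp add: m_def)
    have "step graph_at m a b c" "step graph_at m a b d"
      using j(2) k(2) fm by (auto intro: step_mono simp: m_def)
    then show "c = d" using step_functional[OF fm] by blast
  qed
qed

text \<open>Otherwise each stage would contribute a fact that is absent from its own graph and
  present in all later ones, and these facts would be pairwise distinct.\<close>

lemma closure_stage_exists: "\<exists>i. \<forall>a b c. step graph_at i a b c \<longrightarrow> (a, b, c) \<in> graph_at i"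
proof (rule ccontr)
  assume "\<not> ?thesis"
  then have "\<forall>i. \<exists>t. t \<notin> graph_at i \<and> (\<forall>j>i. t \<in> graph_at j)" by (metis graph_at)
  then obtain t where t: "\<And>i. t i \<notin> graph_at i" "\<And>i j. i < j \<Longrightarrow> t i \<in> graph_at j" by metis
  have "inj t"
  proof (rule injI)
    fix i j assume "t i = t j"
    then show "i = j" using t by (metis linorder_neqE)
  qed
  \<comment> \<open>\<open>stage\<close> is a copy of the type of all sets of facts, so this would
    inject a power set into its base set, against Cantor.\<close>
  then have "inj (t \<circ> Abs_stage)"
    by (intro inj_compose) (auto simp: inj_on_def Abs_stage_inject)
  then have "surj (inv (t \<circ> Abs_stage))" by (rule inj_imp_surj_inv)
  then show False using Cantors_theorem[of UNIV] by auto
qed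

definition last_stage :: stage where
  "last_stage = (SOME i. \<forall>a b c. step graph_at i a b c \<longrightarrow> (a, b, c) \<in> graph_at i)"

definition Graph :: graph where "Graph = graph_at last_stage"

lemma functional_Graph: "functional Graph"
  unfolding Graph_def by (rule functional_graph_at)

lemma step_Graph: "step graph_at last_stage a b c \<Longrightarrow> (a, b, c) \<in> Graph"
  unfolding Graph_def last_stage_def using someI_ex[OF closure_stage_exists] by blast

abbreviation "Tot \<equiv> tot Graph"
abbreviation "Fn \<equiv> fn Graph"

section \<open>Closure properties of the final graph\<close>

lemma Graph_simple:
  "(CK, a, CK1 a) \<in> Graph" "(CK1 a, b, a) \<in> Graph" "(CS, a, CS1 a) \<in> Graph" "(CS1 a, b, CS2 a b) \<in> Graph"
  "(CSucc, Num n, Num (Suc n)) \<in> Graph" "(CR, a, CR1 a) \<in> Graph" "(CR1 a, b, CR2 a b) \<in> Graph"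
  "(CR2 a b, Num 0, b) \<in> Graph"
  by (auto intro!: step_Graph step.intros)

lemma Graph_CS2:
  "\<lbrakk>(a, c, u) \<in> Graph; (b, c, v) \<in> Graph; (u, v, w) \<in> Graph\<rbrakk> \<Longrightarrow> (CS2 a b, c, w) \<in> Graph"
  by (rule step_Graph, rule step.CS2) (auto simp: Graph_def)

lemma Graph_CR2_Suc:
  "\<lbrakk>(CR2 a b, Num n, u) \<in> Graph; (a, Num n, v) \<in> Graph; (v, u, w) \<in> Graph\<rbrakk> \<Longrightarrow>
    (CR2 a b, Num (Suc n), w) \<in> Graph"
  by (rule step_Graph, rule step.CR2_Suc) (auto simp: Graph_def)

lemma Graph_Orc: "set cs \<subseteq> Tot \<Longrightarrow> (Orc l cs, Num n, Num (oracle_fun l (map Fn cs) n)) \<in> Graph"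
  unfolding Graph_def using step.Orc step_Graph[unfolded Graph_def] by blast

lemma Graph_Dec: "c \<in> Tot \<Longrightarrow> (Dec l, c, Num (oracle_fun l [Fn c] 0)) \<in> Graph"
  unfolding Graph_def using step.Dec step_Graph[unfolded Graph_def] by blast

text \<open>The oracle chooses among all functions on the natural numbers; the code
  \<open>Orc l cs\<close> brings its choice into the model.\<close>

lemma Tot_Orc:
  assumes "set cs \<subseteq> Tot"
  shows "Orc l cs \<in> Tot" "Fn (Orc l cs) = oracle_fun l (map Fn cs)"
  using Graph_Orc[OF assms] fn_eq[OF functional_Graph] by (auto simp: tot_def)

text \<open>The number of a function is \<open>to_nat\<close> of its first total code. It depends on
  the function alone, and it determines the function because the code does.\<close>

lemma Graph_Index:
  obtains i where "\<And>c. c \<in> Tot \<Longrightarrow> (Index, c, Num (i (oracle_fun Canon [Fn c]))) \<in> Graph"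
    "inj_on i (Fn ` Tot)"
proof -
  define first where "first f = (SOME d. d \<in> Tot \<and> Fn d = f \<and>
    (\<forall>e\<in>Tot. before graph_at last_stage e d \<longrightarrow> Fn e \<noteq> f))" for f
  have first: "first f \<in> Tot \<and> Fn (first f) = f \<and>
    (\<forall>e\<in>Tot. before graph_at last_stage e (first f) \<longrightarrow> Fn e \<noteq> f)" if "f \<in> Fn ` Tot" for f
  proof -
    obtain d where "Fn d = f" "d \<in> Tot" using \<open>f \<in> Fn ` Tot\<close> by blast
    then have "\<exists>e\<in>Tot. Fn e = f \<and> (\<forall>c\<in>Tot. before graph_at last_stage c e \<longrightarrow> Fn c \<noteq> f)"
      unfolding Graph_def by (rule first_exists)
    then obtain e where "e \<in> Tot \<and> Fn e = f \<and> (\<forall>c\<in>Tot. before graph_at last_stage c e \<longrightarrow> Fn c \<noteq> f)"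
      by blast
    then show ?thesis unfolding first_def by (rule someI)
  qed
  have "(Index, c, Num (to_nat (first (oracle_fun Canon [Fn c])))) \<in> Graph" if "c \<in> Tot" for c
  proof -
    \<comment> \<open>The canonical representation has the code \<open>Orc Canon [c]\<close>,
      whether or not \<open>Fn c\<close> represents a real; hence \<open>Index\<close> is defined on
      all of \<open>Tot\<close>.\<close>
    have "oracle_fun Canon [Fn c] \<in> Fn ` Tot" using Tot_Orc[of "[c]" Canon] that
      by (auto simp: image_iff intro!: bexI[of _ "Orc Canon [c]"])
    from first[OF this] that show ?thesis
      unfolding Graph_def by (intro step_Graph[unfolded Graph_def] step.Index) auto
  qed
  moreover have "inj_on (to_nat \<circ> first) (Fn ` Tot)"
    using first by (intro inj_onI) (metis comp_apply to_nat_split)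
  ultimately show ?thesis using that[of "to_nat \<circ> first"] by simp
qed

text \<open>One result \<open>d\<close> serves all \<open>c'\<close> that agree with
  \<open>c\<close> on total codes, which is the extensionality required of a choice functional. By
  \<open>dec\<close> a code before the first zero has a numeral as value, hence a successor, as the
  rule \<open>Sel\<close> demands.\<close>

lemma Graph_Sel:
  assumes dec: "\<And>e. e \<in> Tot \<Longrightarrow> \<exists>m. (c, e, Num m) \<in> Graph" and "d \<in> Tot" "(c, d, Num 0) \<in> Graph"
  shows "\<exists>d\<in>Tot. (c, d, Num 0) \<in> Graph \<and> (\<forall>c'. (\<forall>e\<in>Tot. \<forall>m. (c, e, Num m) \<in> Graph \<longrightarrow> (c', e, Num m) \<in> Graph) \<longrightarrow>
    (Sel, c', d) \<in> Graph)"
proof -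
  obtain e where e: "(c, e, Num 0) \<in> Graph" "e \<in> Tot"
    "\<And>a. a \<in> Tot \<Longrightarrow> before graph_at last_stage a e \<Longrightarrow> (c, a, Num 0) \<notin> Graph"
    using first_exists[of "\<lambda>d. (c, d, Num 0) \<in> Graph" d last_stage] assms unfolding Graph_def by blast
  have "(Sel, c', e) \<in> Graph"
    if c': "\<forall>e\<in>Tot. \<forall>m. (c, e, Num m) \<in> Graph \<longrightarrow> (c', e, Num m) \<in> Graph" for c'
  proof (rule step_Graph, rule step.Sel)
    show "e \<in> tot (graph_at last_stage)" "(c', e, Num 0) \<in> graph_at last_stage"
      using e c' by (auto simp: Graph_def)
    fix a assume a: "a \<in> tot (graph_at last_stage)" "before graph_at last_stage a e"
    then have "a \<in> Tot" by (simp add: Graph_def)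
    with dec obtain m where m: "(c, a, Num m) \<in> Graph" by blast
    with e(3)[OF \<open>a \<in> Tot\<close> a(2)] obtain m' where "m = Suc m'" by (cases m) auto
    with m c' \<open>a \<in> Tot\<close> show "\<exists>m. (c', a, Num (Suc m)) \<in> graph_at last_stage"
      by (auto simp: Graph_def)
  qed
  with e show ?thesis by blast
qed

lemma Graph_SelN:
  assumes dec: "\<And>n. \<exists>m. (c, Num n, Num m) \<in> Graph" and "(c, Num n, Num 0) \<in> Graph"
  shows "\<exists>n. (c, Num n, Num 0) \<in> Graph \<and> (\<forall>c'. (\<forall>n m. (c, Num n, Num m) \<in> Graph \<longrightarrow> (c', Num n, Num m) \<in> Graph) \<longrightarrow>
    (SelN, c', Num n) \<in> Graph)"
proof -
  define n where "n = (LEAST n. (c, Num n, Num 0) \<in> Graph)"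
  have n: "(c, Num n, Num 0) \<in> Graph" unfolding n_def using assms(2) by (rule LeastI)
  have "(SelN, c', Num n) \<in> Graph"
    if c': "\<forall>n m. (c, Num n, Num m) \<in> Graph \<longrightarrow> (c', Num n, Num m) \<in> Graph" for c'
  proof (rule step_Graph, rule step.SelN)
    show "(c', Num n, Num 0) \<in> graph_at last_stage" using n c' by (auto simp: Graph_def)
    fix i assume i: "i < n"
    obtain m where m: "(c, Num i, Num m) \<in> Graph" using dec by blast
    with not_less_Least[OF i[unfolded n_def]] obtain m' where "m = Suc m'" by (cases m) auto
    with m c' show "\<exists>m. (c', Num i, Num (Suc m)) \<in> graph_at last_stage" by (auto simp: Graph_def)
  qed
  with n show ?thesis by blast
qed

section \<open>Hereditarily extensional operations\<close>

definition ap :: "code \<Rightarrow> code \<Rightarrow> code" where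
  "ap a b = (THE c. (a, b, c) \<in> Graph)"

lemma ap_eq: "(a, b, c) \<in> Graph \<Longrightarrow> ap a b = c"
  unfolding ap_def by (blast dest: functionalD[OF functional_Graph])

text \<open>The partial equivalence relations of the model HEO: codes related to themselves are the
  objects of the type, and related codes stand for the same object.\<close>

fun D :: "ty \<Rightarrow> code \<Rightarrow> code \<Rightarrow> bool" where
  "D N a b \<longleftrightarrow> (\<exists>n. a = Num n \<and> b = Num n)"
| "D (\<sigma> \<rightarrow>\<^sub>t \<tau>) a b \<longleftrightarrow>
    (\<forall>c d. D \<sigma> c d \<longrightarrow> (\<exists>u v. (a, c, u) \<in> Graph \<and> (b, d, v) \<in> Graph \<and> D \<tau> u v))"

lemma D_ap: "D (\<sigma> \<rightarrow>\<^sub>t \<tau>) a b \<Longrightarrow> D \<sigma> c d \<Longrightarrow> D \<tau> (ap a c) (ap b d)"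
  using ap_eq by fastforce

lemma D_Graph: "D (\<sigma> \<rightarrow>\<^sub>t \<tau>) a b \<Longrightarrow> D \<sigma> c d \<Longrightarrow> (a, c, ap a c) \<in> Graph"
  using ap_eq by fastforce

lemma D_FunI:
  assumes "\<And>c d. D \<sigma> c d \<Longrightarrow> \<exists>u v. (a, c, u) \<in> Graph \<and> (b, d, v) \<in> Graph \<and> D \<tau> u v"
  shows "D (\<sigma> \<rightarrow>\<^sub>t \<tau>) a b"
  using assms by simp

lemma D_FunI_total:
  assumes "\<And>c. (a, c, f c) \<in> Graph" "\<And>c. (b, c, g c) \<in> Graph" "\<And>c d. D \<sigma> c d \<Longrightarrow> D \<tau> (f c) (g d)"
  shows "D (\<sigma> \<rightarrow>\<^sub>t \<tau>) a b"
  using assms by (intro D_FunI) blast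

lemma D_nonempty: "\<exists>a. D \<sigma> a a"
proof (induction \<sigma>)
  case (Fun \<sigma> \<tau>)
  then obtain a where "D \<tau> a a" by blast
  then have "D (\<sigma> \<rightarrow>\<^sub>t \<tau>) (CK1 a) (CK1 a)" using Graph_simple(2) by (intro D_FunI) blast
  then show ?case by blast
qed auto

text \<open>Both properties go through one induction: transitivity at a function type first needs
  the left argument related to itself, and that combines symmetry and transitivity at the argument
  type.\<close>

lemma D_sym_trans: "(D \<sigma> a b \<longrightarrow> D \<sigma> b a) \<and> (D \<sigma> a b \<longrightarrow> D \<sigma> b c \<longrightarrow> D \<sigma> a c)"
proof (induction \<sigma> arbitrary: a b c)
  case (Fun \<sigma> \<tau>)
  have sym: "D (\<sigma> \<rightarrow>\<^sub>t \<tau>) b a" if "D (\<sigma> \<rightarrow>\<^sub>t \<tau>) a b" for a b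
  proof (rule D_FunI)
    fix c d assume "D \<sigma> c d"
    then have "D \<sigma> d c" using Fun.IH(1) by blast
    then show "\<exists>u v. (b, c, u) \<in> Graph \<and> (a, d, v) \<in> Graph \<and> D \<tau> u v"
      using that Fun.IH(2) unfolding D.simps by blast
  qed
  have "D (\<sigma> \<rightarrow>\<^sub>t \<tau>) a c" if ab: "D (\<sigma> \<rightarrow>\<^sub>t \<tau>) a b" and bc: "D (\<sigma> \<rightarrow>\<^sub>t \<tau>) b c"
  proof (rule D_FunI)
    fix x y assume xy: "D \<sigma> x y"
    then have "D \<sigma> x x" using Fun.IH(1) by blast
    then have "(a, x, ap a x) \<in> Graph" "D \<tau> (ap a x) (ap b x)" using ab D_ap D_Graph by blast+
    moreover have "D \<tau> (ap b x) (ap c y)" using bc xy D_ap by blast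
    moreover have "(c, y, ap c y) \<in> Graph"
      using sym[OF bc] xy Fun.IH(1) D_Graph by blast
    ultimately show "\<exists>u v. (a, x, u) \<in> Graph \<and> (c, y, v) \<in> Graph \<and> D \<tau> u v"
      using Fun.IH(2) by blast
  qed
  with sym show ?case by blast
qed auto

lemma D_sym: "D \<sigma> a b \<Longrightarrow> D \<sigma> b a"
  and D_trans: "D \<sigma> a b \<Longrightarrow> D \<sigma> b c \<Longrightarrow> D \<sigma> a c"
  using D_sym_trans by blast+

lemma D_refl_left: "D \<sigma> a b \<Longrightarrow> D \<sigma> a a"
  using D_sym D_trans by blast

lemma D_FunI_pointwise:
  assumes a: "D (\<sigma> \<rightarrow>\<^sub>t \<tau>) a a" and b: "D (\<sigma> \<rightarrow>\<^sub>t \<tau>) b b"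
    and eq: "\<And>c. D \<sigma> c c \<Longrightarrow> D \<tau> (ap a c) (ap b c)"
  shows "D (\<sigma> \<rightarrow>\<^sub>t \<tau>) a b"
proof (rule D_FunI)
  fix c d assume cd: "D \<sigma> c d"
  have "D \<tau> (ap a c) (ap b d)"
    using eq[OF D_refl_left[OF cd]] D_ap[OF b cd] D_trans by blast
  then show "\<exists>u v. (a, c, u) \<in> Graph \<and> (b, d, v) \<in> Graph \<and> D \<tau> u v"
    using D_Graph[OF a cd] D_Graph[OF b D_sym[OF cd]] by blast
qed

lemma ap_simps [simp]:
  "ap CK a = CK1 a" "ap (CK1 a) b = a" "ap CS a = CS1 a" "ap (CS1 a) b = CS2 a b"
  "ap CSucc (Num n) = Num (Suc n)" "ap CR a = CR1 a" "ap (CR1 a) b = CR2 a b" "ap (CR2 a b) (Num 0) = b"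
  using Graph_simple ap_eq by blast+

lemma D_CK: "D (\<sigma> \<rightarrow>\<^sub>t \<tau> \<rightarrow>\<^sub>t \<sigma>) CK CK"
  by (rule D_FunI_total[OF Graph_simple(1) Graph_simple(1)])
    (rule D_FunI_total[OF Graph_simple(2) Graph_simple(2)])

lemma CS2_ap:
  assumes "D (\<rho> \<rightarrow>\<^sub>t \<sigma> \<rightarrow>\<^sub>t \<tau>) a a" "D (\<rho> \<rightarrow>\<^sub>t \<sigma>) b b" "D \<rho> c c"
  shows "(CS2 a b, c, ap (ap a c) (ap b c)) \<in> Graph"
  using assms by (intro Graph_CS2) (auto intro: D_Graph D_ap simp del: D.simps)

lemma ap_CS2:
  assumes "D (\<rho> \<rightarrow>\<^sub>t \<sigma> \<rightarrow>\<^sub>t \<tau>) a a" "D (\<rho> \<rightarrow>\<^sub>t \<sigma>) b b" "D \<rho> c c"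
  shows "ap (CS2 a b) c = ap (ap a c) (ap b c)"
  using CS2_ap[OF assms] by (rule ap_eq)

lemma D_CS: "D ((\<rho> \<rightarrow>\<^sub>t \<sigma> \<rightarrow>\<^sub>t \<tau>) \<rightarrow>\<^sub>t (\<rho> \<rightarrow>\<^sub>t \<sigma>) \<rightarrow>\<^sub>t \<rho> \<rightarrow>\<^sub>t \<tau>) CS CS"
proof (rule D_FunI_total[OF Graph_simple(3) Graph_simple(3)],
    rule D_FunI_total[OF Graph_simple(4) Graph_simple(4)], intro D_FunI exI conjI)
  fix a a' b b' c c'
  assume a: "D (\<rho> \<rightarrow>\<^sub>t \<sigma> \<rightarrow>\<^sub>t \<tau>) a a'" and b: "D (\<rho> \<rightarrow>\<^sub>t \<sigma>) b b'" and c: "D \<rho> c c'"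
  show "(CS2 a b, c, ap (ap a c) (ap b c)) \<in> Graph"
    using a b c by (intro CS2_ap) (rule D_refl_left, assumption)+
  show "(CS2 a' b', c', ap (ap a' c') (ap b' c')) \<in> Graph"
    using a b c by (intro CS2_ap) (rule D_refl_left, rule D_sym, assumption)+
  show "D \<tau> (ap (ap a c) (ap b c)) (ap (ap a' c') (ap b' c'))"
    using D_ap[OF D_ap[OF a c] D_ap[OF b c]] .
qed

lemma CR2_Suc_Graph:
  assumes "D (N \<rightarrow>\<^sub>t N \<rightarrow>\<^sub>t N) a a" "(CR2 a b, Num n, Num u) \<in> Graph"
  shows "(CR2 a b, Num (Suc n), ap (ap a (Num n)) (Num u)) \<in> Graph"
proof (rule Graph_CR2_Suc[OF assms(2)])
  have n: "D N (Num k) (Num k)" for k by simp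
  show "(a, Num n, ap a (Num n)) \<in> Graph" using D_Graph[OF assms(1) n] .
  show "(ap a (Num n), Num u, ap (ap a (Num n)) (Num u)) \<in> Graph"
    using D_Graph[OF D_ap[OF assms(1) n] n] .
qed

text \<open>Induction on the recursion argument. Extensionally equal step functions produce
  literally the same numerals, since \<open>D N\<close> is identity on numerals.\<close>

lemma CR2_total:
  assumes a: "D (N \<rightarrow>\<^sub>t N \<rightarrow>\<^sub>t N) a a'"
  shows "\<exists>m. (CR2 a (Num b), Num n, Num m) \<in> Graph \<and> (CR2 a' (Num b), Num n, Num m) \<in> Graph"
proof (induction n)
  case 0
  then show ?case using Graph_simple(8) by blast
next
  case (Suc n)
  then obtain m where m: "(CR2 a (Num b), Num n, Num m) \<in> Graph" "(CR2 a' (Num b), Num n, Num m) \<in> Graph"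
    by blast
  have "D N (ap (ap a (Num n)) (Num m)) (ap (ap a' (Num n)) (Num m))"
    by (rule D_ap[OF D_ap[OF a]]) simp_all
  then obtain k where k: "ap (ap a (Num n)) (Num m) = Num k" "ap (ap a' (Num n)) (Num m) = Num k"
    by auto
  show ?case
    using CR2_Suc_Graph[OF D_refl_left[OF a] m(1)] CR2_Suc_Graph[OF D_refl_left[OF D_sym[OF a]] m(2)] k
    by auto
qed

lemma D_CR: "D ((N \<rightarrow>\<^sub>t N \<rightarrow>\<^sub>t N) \<rightarrow>\<^sub>t N \<rightarrow>\<^sub>t N \<rightarrow>\<^sub>t N) CR CR"
proof (rule D_FunI_total[OF Graph_simple(6) Graph_simple(6)],
    rule D_FunI_total[OF Graph_simple(7) Graph_simple(7)], rule D_FunI)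
  fix a a' b b' c c'
  assume a: "D (N \<rightarrow>\<^sub>t N \<rightarrow>\<^sub>t N) a a'" and "D N b b'" "D N c c'"
  then obtain x n where [simp]: "b = Num x" "b' = Num x" "c = Num n" "c' = Num n" by auto
  show "\<exists>u v. (CR2 a b, c, u) \<in> Graph \<and> (CR2 a' b', c', v) \<in> Graph \<and> D N u v"
    using CR2_total[OF a, of x n] by auto
qed

lemma ap_CR2_Suc:
  assumes "D (N \<rightarrow>\<^sub>t N \<rightarrow>\<^sub>t N) a a"
  shows "ap (CR2 a (Num b)) (Num (Suc n)) = ap (ap a (Num n)) (ap (CR2 a (Num b)) (Num n))"
proof -
  obtain m where m: "(CR2 a (Num b), Num n, Num m) \<in> Graph" using CR2_total[OF assms] by blast
  show ?thesis using ap_eq[OF CR2_Suc_Graph[OF assms m]] ap_eq[OF m] by simp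
qed

lemma D_CSucc: "D (N \<rightarrow>\<^sub>t N) CSucc CSucc"
  using Graph_simple(5) by fastforce


section \<open>Tarskian semantics and soundness\<close>

primrec ev :: "(var \<Rightarrow> code) \<Rightarrow> tm \<Rightarrow> code" where
  "ev \<rho> (Var v) = \<rho> v"
| "ev \<rho> Zero = Num 0"
| "ev \<rho> Succ = CSucc"
| "ev \<rho> (Kc \<sigma> \<tau>) = CK"
| "ev \<rho> (Sc \<rho>' \<sigma> \<tau>) = CS"
| "ev \<rho> Rec0 = CR"
| "ev \<rho> (s \<cdot> t) = ap (ev \<rho> s) (ev \<rho> t)"

definition valuation :: "(var \<Rightarrow> code) \<Rightarrow> bool" where
  "valuation \<rho> \<longleftrightarrow> (\<forall>v. D (snd v) (\<rho> v) (\<rho> v))"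

lemma valuation_upd [simp]: "valuation \<rho> \<Longrightarrow> D (snd v) c c \<Longrightarrow> valuation (\<rho>(v := c))"
  unfolding valuation_def by auto

lemma valuation_exists: "\<exists>\<rho>. valuation \<rho>"
proof
  show "valuation (\<lambda>v. SOME a. D (snd v) a a)"
    unfolding valuation_def using someI_ex[OF D_nonempty] by blast
qed

lemma D_ev: "wt t \<Longrightarrow> valuation \<rho> \<Longrightarrow> D (ty_of t) (ev \<rho> t) (ev \<rho> t)"
proof (induction t)
  case (App s t)
  then show ?case using D_ap by fastforce
qed (auto simp: valuation_def D_CSucc[simplified] simp del: D.simps(2) intro: D_CK D_CS D_CR D_CSucc)

lemma ev_cong: "(\<And>v. v \<in> fv_tm t \<Longrightarrow> \<rho> v = \<rho>' v) \<Longrightarrow> ev \<rho> t = ev \<rho>' t"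
  by (induction t) auto

lemma ev_upd [simp]: "v \<notin> fv_tm t \<Longrightarrow> ev (\<rho>(v := c)) t = ev \<rho> t"
  by (rule ev_cong) auto

lemma ev_subst: "ev \<rho> (subst_tm v r t) = ev (\<rho>(v := ev \<rho> r)) t"
  by (induction t) auto

primrec sat :: "(var \<Rightarrow> code) \<Rightarrow> fm \<Rightarrow> bool" where
  "sat \<rho> (s \<^bold>= t) \<longleftrightarrow> ev \<rho> s = ev \<rho> t"
| "sat \<rho> Falsum \<longleftrightarrow> False"
| "sat \<rho> (\<phi> \<^bold>\<longrightarrow> \<psi>) \<longleftrightarrow> (sat \<rho> \<phi> \<longrightarrow> sat \<rho> \<psi>)"
| "sat \<rho> (Forall v \<phi>) \<longleftrightarrow> (\<forall>c. D (snd v) c c \<longrightarrow> sat (\<rho>(v := c)) \<phi>)"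

lemma sat_simps [simp]:
  "sat \<rho> (\<^bold>\<not> \<phi>) \<longleftrightarrow> \<not> sat \<rho> \<phi>"
  "sat \<rho> (\<phi> \<^bold>\<and> \<psi>) \<longleftrightarrow> sat \<rho> \<phi> \<and> sat \<rho> \<psi>"
  "sat \<rho> (\<phi> \<^bold>\<or> \<psi>) \<longleftrightarrow> sat \<rho> \<phi> \<or> sat \<rho> \<psi>"
  "sat \<rho> (\<phi> \<^bold>\<longleftrightarrow> \<psi>) \<longleftrightarrow> (sat \<rho> \<phi> \<longleftrightarrow> sat \<rho> \<psi>)"
  "sat \<rho> (Exists v \<phi>) \<longleftrightarrow> (\<exists>c. D (snd v) c c \<and> sat (\<rho>(v := c)) \<phi>)"
  by (auto simp: Neg_def Conj_def Disj_def Iff_def Exists_def)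

lemma sat_cong: "(\<And>v. v \<in> fv \<phi> \<Longrightarrow> \<rho> v = \<rho>' v) \<Longrightarrow> sat \<rho> \<phi> \<longleftrightarrow> sat \<rho>' \<phi>"
proof (induction \<phi> arbitrary: \<rho> \<rho>')
  case (Eq s t)
  then show ?case using ev_cong[of s \<rho> \<rho>'] ev_cong[of t \<rho> \<rho>'] by simp
next
  case (Imp \<phi> \<psi>)
  then show ?case by (metis UnCI fv.simps(3) sat.simps(3))
next
  case (Forall v \<phi>)
  have "sat (\<rho>(v := c)) \<phi> \<longleftrightarrow> sat (\<rho>'(v := c)) \<phi>" for c
    by (rule Forall.IH) (use Forall.prems in auto)
  then show ?case by simp
qed simp

lemma sat_upd: "v \<notin> fv \<phi> \<Longrightarrow> sat (\<rho>(v := c)) \<phi> \<longleftrightarrow> sat \<rho> \<phi>"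
  by (rule sat_cong) auto

lemma subst_tm_notfree: "v \<notin> fv_tm t \<Longrightarrow> subst_tm v r t = t"
  by (induction t) auto

lemma subst_notfree: "v \<notin> fv \<phi> \<Longrightarrow> subst v r \<phi> = \<phi>"
  by (induction \<phi>) (auto simp: subst_tm_notfree)

lemma sat_subst: "free_for v r \<phi> \<Longrightarrow> sat \<rho> (subst v r \<phi>) \<longleftrightarrow> sat (\<rho>(v := ev \<rho> r)) \<phi>"
proof (induction \<phi> arbitrary: \<rho>)
  case (Forall w \<phi>)
  show ?case
  proof (cases "v \<in> fv (Forall w \<phi>)")
    case True
    then have "w \<noteq> v" "w \<notin> fv_tm r" "free_for v r \<phi>" using Forall.prems by auto
    then show ?thesis using Forall.IH by (simp add: fun_upd_twist[of w v] del: fun_upd_apply)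
  next
    case False
    then show ?thesis by (simp only: subst_notfree[OF False] sat_upd[OF False])
  qed
qed (simp_all add: ev_subst)

lemma free_for_qf: "qf \<phi> \<Longrightarrow> free_for v r \<phi>"
  by (induction \<phi>) auto

text \<open>Quantifying over all valuations takes care of generalisation, and \<open>D_ev\<close>
  ensures that an instantiating term denotes an object of its sort.\<close>

lemma soundness:
  assumes "T \<turnstile> \<phi>" and "\<And>\<psi> \<rho>. \<psi> \<in> T \<Longrightarrow> valuation \<rho> \<Longrightarrow> sat \<rho> \<psi>"
  shows "valuation \<rho> \<Longrightarrow> sat \<rho> \<phi>"
  using assms(1)
proof (induction arbitrary: \<rho> rule: derives.induct)
  case (axiom \<phi>)
  then show ?case using assms(2) by blast
next
  case (inst \<phi> t v)
  then have "D (snd v) (ev \<rho> t) (ev \<rho> t)" using D_ev by metis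
  then show ?case using inst by (simp add: sat_subst)
next
  case (distr \<phi> \<psi> v)
  then show ?case by (auto simp: sat_upd)
qed auto

lemma fresh_notfree: "fresh t \<le> i \<Longrightarrow> (i, \<sigma>) \<notin> fv_tm t"
  by (induction t) auto

text \<open>Objects of a function type are related as soon as they agree at each single argument
  (\<open>D_FunI_pointwise\<close>). The extensionality axiom thus becomes an instance of
  \<open>D_ap\<close>.\<close>

lemma sat_eq_at:
  "\<lbrakk>wt s; wt t; ty_of s = \<sigma>; ty_of t = \<sigma>; valuation \<rho>\<rbrakk> \<Longrightarrow>
    sat \<rho> (eq_at \<sigma> s t) \<longleftrightarrow> D \<sigma> (ev \<rho> s) (ev \<rho> t)"
proof (induction \<sigma> arbitrary: s t \<rho>)
  case N
  then show ?case using D_ev[of s \<rho>] D_ev[of t \<rho>] by auto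
next
  case (Fun \<sigma> \<tau>)
  let ?y = "(max (fresh s) (fresh t), \<sigma>)"
  have y: "?y \<notin> fv_tm s" "?y \<notin> fv_tm t" by (auto intro!: fresh_notfree)
  have D: "D (\<sigma> \<rightarrow>\<^sub>t \<tau>) (ev \<rho> s) (ev \<rho> s)" "D (\<sigma> \<rightarrow>\<^sub>t \<tau>) (ev \<rho> t) (ev \<rho> t)"
    using D_ev[of s \<rho>] D_ev[of t \<rho>] Fun.prems by (auto simp del: D.simps)
  have "sat (\<rho>(?y := c)) (eq_at \<tau> (s \<cdot> Var ?y) (t \<cdot> Var ?y)) \<longleftrightarrow> D \<tau> (ap (ev \<rho> s) c) (ap (ev \<rho> t) c)"
    if "D \<sigma> c c" for c
    using Fun.IH(2)[of "s \<cdot> Var ?y" "t \<cdot> Var ?y" "\<rho>(?y := c)"] Fun.prems that y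
    by (simp del: fun_upd_apply add: fun_upd_same)
  then have "sat \<rho> (eq_at (\<sigma> \<rightarrow>\<^sub>t \<tau>) s t) \<longleftrightarrow> (\<forall>c. D \<sigma> c c \<longrightarrow> D \<tau> (ap (ev \<rho> s) c) (ap (ev \<rho> t) c))"
    by (simp add: Let_def)
  also have "\<dots> \<longleftrightarrow> D (\<sigma> \<rightarrow>\<^sub>t \<tau>) (ev \<rho> s) (ev \<rho> t)"
    using D D_FunI_pointwise D_ap by blast
  finally show ?case .
qed

lemma valuationD: "valuation \<rho> \<Longrightarrow> D \<sigma> (\<rho> (i, \<sigma>)) (\<rho> (i, \<sigma>))"
  unfolding valuation_def by force

lemma valuation_N: "valuation \<rho> \<Longrightarrow> \<exists>n. \<rho> (i, N) = Num n"
  using valuationD[of \<rho> N i] by auto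

lemma sat_E_PRA:
  assumes "\<phi> \<in> E_PRA" and \<rho>: "valuation \<rho>"
  shows "sat \<rho> \<phi>"
  using assms(1)
proof cases
  case succ_nonzero
  then show ?thesis using valuation_N[OF \<rho>, of 0] by auto
next
  case succ_inj
  then show ?thesis using valuation_N[OF \<rho>, of 0] valuation_N[OF \<rho>, of 1] by auto
next
  case (comb_K \<sigma> \<tau>)
  show ?thesis unfolding comb_K
    by (subst sat_eq_at) (use \<rho> in \<open>auto simp: valuationD simp del: D.simps\<close>)
next
  case (comb_S \<tau> \<rho>' \<sigma>)
  let ?a = "\<rho> (0, \<rho>' \<rightarrow>\<^sub>t \<sigma> \<rightarrow>\<^sub>t \<tau>)" and ?b = "\<rho> (1, \<rho>' \<rightarrow>\<^sub>t \<sigma>)" and ?c = "\<rho> (2, \<rho>')"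
  have D: "D (\<rho>' \<rightarrow>\<^sub>t \<sigma> \<rightarrow>\<^sub>t \<tau>) ?a ?a" "D (\<rho>' \<rightarrow>\<^sub>t \<sigma>) ?b ?b" "D \<rho>' ?c ?c" by (rule valuationD[OF \<rho>])+
  have "D \<tau> (ap (ap ?a ?c) (ap ?b ?c)) (ap (ap ?a ?c) (ap ?b ?c))"
    using D D_ap by blast
  then show ?thesis unfolding comb_S
    by (subst sat_eq_at) (use \<rho> in \<open>auto simp: ap_CS2[OF D] simp del: D.simps One_nat_def\<close>)
next
  case rec_0
  then show ?thesis using valuation_N[OF \<rho>, of 1] by auto
next
  case rec_Succ
  then show ?thesis
    using valuation_N[OF \<rho>, of 1] valuation_N[OF \<rho>, of 2] valuationD[OF \<rho>, of "N \<rightarrow>\<^sub>t N \<rightarrow>\<^sub>t N" 0]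
    by (auto simp: ap_CR2_Suc simp del: D.simps)
next
  case (qf_induction \<psi> x)
  \<comment> \<open>The objects of type \<open>N\<close> are exactly the numerals, so induction on
    \<open>n\<close> in the metatheory suffices.\<close>
  have "sat (\<rho>(x := Num n)) \<psi>"
    if "sat \<rho> (subst x Zero \<psi>)" "sat \<rho> (Forall x (\<psi> \<^bold>\<longrightarrow> subst x (Succ \<cdot> Var x) \<psi>))" for n
    using that qf_induction
    by (induction n) (auto simp: sat_subst free_for_qf)
  then show ?thesis using qf_induction by auto
next
  case (extensionality \<sigma> \<tau>)
  show ?thesis unfolding extensionality sat.simps
    by (subst sat_eq_at; (subst sat_eq_at)?)
      (use \<rho> D_ap[OF valuationD[OF \<rho>, of "\<sigma> \<rightarrow>\<^sub>t \<tau>" 2]] in \<open>auto simp del: D.simps\<close>)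
qed auto

section \<open>Bracket abstraction in the model\<close>

lemma wt_lam [simp]: "wt t \<Longrightarrow> wt (lam v t)"
  and ty_of_lam [simp]: "wt t \<Longrightarrow> ty_of (lam v t) = snd v \<rightarrow>\<^sub>t ty_of t"
proof -
  have "wt t \<Longrightarrow> wt (lam v t) \<and> ty_of (lam v t) = snd v \<rightarrow>\<^sub>t ty_of t" by (induction t) auto
  then show "wt t \<Longrightarrow> wt (lam v t)" "wt t \<Longrightarrow> ty_of (lam v t) = snd v \<rightarrow>\<^sub>t ty_of t" by blast+
qed

lemma fv_lam [simp]: "fv_tm (lam v t) = fv_tm t - {v}"
  by (induction t) auto

lemma ap_lam [simp]:
  "\<lbrakk>wt t; valuation \<rho>; D (snd v) c c\<rbrakk> \<Longrightarrow> ap (ev \<rho> (lam v t)) c = ev (\<rho>(v := c)) t"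
proof (induction t)
  case (Var w)
  have K: "(CK, c, CK1 c) \<in> Graph" "(CK1 c, CK1 c, c) \<in> Graph" by (rule Graph_simple)+
  have "(CS2 CK CK, c, c) \<in> Graph" by (rule Graph_CS2[OF K(1) K(1) K(2)])
  then show ?case by (simp add: ap_eq)
next
  case (App s t)
  show ?case
  proof (cases "v \<in> fv_tm (s \<cdot> t)")
    case True
    obtain \<tau> where st: "wt s" "wt t" "ty_of s = ty_of t \<rightarrow>\<^sub>t \<tau>" using App.prems by auto
    have "D (snd v \<rightarrow>\<^sub>t ty_of t \<rightarrow>\<^sub>t \<tau>) (ev \<rho> (lam v s)) (ev \<rho> (lam v s))"
      "D (snd v \<rightarrow>\<^sub>t ty_of t) (ev \<rho> (lam v t)) (ev \<rho> (lam v t))"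
      using D_ev[of "lam v s" \<rho>] D_ev[of "lam v t" \<rho>] st App.prems by (auto simp del: D.simps)
    from ap_CS2[OF this App.prems(3)] True App st show ?thesis by auto
  next
    case False
    then show ?thesis by (auto simp del: fun_upd_apply)
  qed
qed auto

section \<open>Arithmetic, choice and comprehension in the model\<close>

declare lam.simps [simp del]

text \<open>Type 1 of the model thus consists of the functions that have a total code, with true
  equality of functions.\<close>

lemma D_T1_iff: "D T1 a b \<longleftrightarrow> a \<in> Tot \<and> b \<in> Tot \<and> Fn a = Fn b"
proof
  assume ab: "D T1 a b"
  have ex: "\<exists>m. (a, Num n, Num m) \<in> Graph \<and> (b, Num n, Num m) \<in> Graph" for n
    using ab by fastforce
  then have "Fn a n = Fn b n" for n using fn_eq[OF functional_Graph] by metis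
  with ex show "a \<in> Tot \<and> b \<in> Tot \<and> Fn a = Fn b"
    unfolding tot_def by blast
next
  assume "a \<in> Tot \<and> b \<in> Tot \<and> Fn a = Fn b"
  then show "D T1 a b" using tot_fn[OF functional_Graph] by fastforce
qed

lemma D_T1_refl: "D T1 a a \<longleftrightarrow> a \<in> Tot"
  by (simp add: D_T1_iff del: D.simps)

lemma ap_Tot [simp]: "c \<in> Tot \<Longrightarrow> ap c (Num n) = Num (Fn c n)"
  using tot_fn[OF functional_Graph] ap_eq by blast

lemma ev_Tot [simp]: "valuation \<rho> \<Longrightarrow> \<rho> (i, T1) \<in> Tot"
  using valuationD[of \<rho> T1 i] by (simp add: D_T1_refl del: D.simps)

text \<open>Evaluating a recursive term below is reduced to an identity about
  \<open>rec_nat\<close>; \<open>g\<close> is the numerical meaning of the body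
  \<open>t\<close>.\<close>

lemma ev_rec:
  assumes t: "wt t" "ty_of t = N" "valuation \<rho>"
    and g: "\<And>n x. ev (\<rho>((2, N) := Num n, (3, N) := Num x)) t = Num (g n x)"
  shows "ap (CR2 (ev \<rho> (lam0 2 (lam0 3 t))) (Num a)) (Num b) = Num (rec_nat a g b)"
proof (induction b)
  case (Suc b)
  have "D (N \<rightarrow>\<^sub>t N \<rightarrow>\<^sub>t N) (ev \<rho> (lam0 2 (lam0 3 t))) (ev \<rho> (lam0 2 (lam0 3 t)))"
    using D_ev[of "lam0 2 (lam0 3 t)" \<rho>] t by (simp del: D.simps)
  then show ?case using Suc t by (simp add: ap_CR2_Suc g)
qed simp

section \<open>Evaluation of the arithmetical terms\<close>

lemma tm_One [simp]: "wt One" "ty_of One = N" "fv_tm One = {}"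
  by (simp_all add: One_def)
lemma tm_Add [simp]: "wt Add" "ty_of Add = N \<rightarrow>\<^sub>t N \<rightarrow>\<^sub>t N" "fv_tm Add = {}"
  by (auto simp: Add_def)
lemma tm_Mul [simp]: "wt Mul" "ty_of Mul = N \<rightarrow>\<^sub>t N \<rightarrow>\<^sub>t N" "fv_tm Mul = {}"
  by (auto simp: Mul_def)
lemma tm_Pred [simp]: "wt Pred" "ty_of Pred = N \<rightarrow>\<^sub>t N" "fv_tm Pred = {}"
  by (auto simp: Pred_def)
lemma tm_Monus [simp]: "wt Monus" "ty_of Monus = N \<rightarrow>\<^sub>t N \<rightarrow>\<^sub>t N" "fv_tm Monus = {}"
  by (auto simp: Monus_def)
lemma tm_Exp2 [simp]: "wt Exp2" "ty_of Exp2 = N \<rightarrow>\<^sub>t N" "fv_tm Exp2 = {}"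
  by (auto simp: Exp2_def)
lemma tm_Tri [simp]: "wt Tri" "ty_of Tri = N \<rightarrow>\<^sub>t N" "fv_tm Tri = {}"
  by (auto simp: Tri_def)
lemma tm_CPair [simp]: "wt CPair" "ty_of CPair = N \<rightarrow>\<^sub>t N \<rightarrow>\<^sub>t N" "fv_tm CPair = {}"
  by (auto simp: CPair_def)
lemma tm_Root [simp]: "wt Root" "ty_of Root = N \<rightarrow>\<^sub>t N" "fv_tm Root = {}"
  by (auto simp: Root_def)
lemma tm_Snd [simp]: "wt Snd" "ty_of Snd = N \<rightarrow>\<^sub>t N" "fv_tm Snd = {}"
  by (auto simp: Snd_def)
lemma tm_Fst [simp]: "wt Fst" "ty_of Fst = N \<rightarrow>\<^sub>t N" "fv_tm Fst = {}"
  by (auto simp: Fst_def)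
lemma tm_Bar [simp]: "wt Bar" "ty_of Bar = T1 \<rightarrow>\<^sub>t N \<rightarrow>\<^sub>t N" "fv_tm Bar = {}"
  by (auto simp: Bar_def)

lemma ev_One [simp]: "ev \<rho> One = Num 1"
  by (simp add: One_def)

lemma ev_Add [simp]:
  assumes "valuation \<rho>" shows "ap (ap (ev \<rho> Add) (Num a)) (Num b) = Num (a + b)"
proof -
  have "rec_nat a (\<lambda>n x. Suc x) b = a + b" by (induction b) auto
  then show ?thesis unfolding Add_def using assms by (simp add: ev_rec[where g = "\<lambda>n x. Suc x"])
qed

lemma ev_Mul [simp]:
  assumes "valuation \<rho>" shows "ap (ap (ev \<rho> Mul) (Num a)) (Num b) = Num (a * b)"
proof -
  have "rec_nat 0 (\<lambda>n x. x + a) b = a * b" by (induction b) auto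
  then show ?thesis unfolding Mul_def using assms by (simp add: ev_rec[where g = "\<lambda>n x. x + a"])
qed

lemma ev_Pred [simp]:
  assumes "valuation \<rho>" shows "ap (ev \<rho> Pred) (Num a) = Num (a - 1)"
proof -
  have "rec_nat 0 (\<lambda>n x. n) a = a - 1" by (induction a) auto
  then show ?thesis unfolding Pred_def using assms by (simp add: ev_rec[where g = "\<lambda>n x. n"])
qed

lemma ev_Monus [simp]:
  assumes "valuation \<rho>" shows "ap (ap (ev \<rho> Monus) (Num a)) (Num b) = Num (a - b)"
proof -
  have "rec_nat a (\<lambda>n x. x - 1) b = a - b" by (induction b) auto
  then show ?thesis unfolding Monus_def using assms by (simp add: ev_rec[where g = "\<lambda>n x. x - 1"])
qed

lemma ev_Exp2 [simp]:
  assumes "valuation \<rho>" shows "ap (ev \<rho> Exp2) (Num a) = Num (2 ^ a)"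
proof -
  have "rec_nat 1 (\<lambda>n x. x + x) a = (2::nat) ^ a" by (induction a) auto
  then show ?thesis unfolding Exp2_def using assms by (simp add: ev_rec[where g = "\<lambda>n x. x + x"])
qed

lemma ev_Tri [simp]:
  assumes "valuation \<rho>" shows "ap (ev \<rho> Tri) (Num a) = Num (tri a)"
proof -
  have "rec_nat 0 (\<lambda>n x. x + Suc n) a = tri a" by (induction a) auto
  then show ?thesis unfolding Tri_def using assms by (simp add: ev_rec[where g = "\<lambda>n x. x + Suc n"])
qed

lemma ev_CPair [simp]:
  assumes "valuation \<rho>" shows "ap (ap (ev \<rho> CPair) (Num a)) (Num b) = Num (cpair a b)"
  unfolding CPair_def using assms by (simp add: cpair_def)

lemma ev_Root [simp]:
  assumes "valuation \<rho>" shows "ap (ev \<rho> Root) (Num a) = Num (root a)"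
proof -
  let ?g = "\<lambda>n x. x + (1 - (tri (Suc x) - Suc n))"
  have "rec_nat 0 ?g a = root a" by (induction a) auto
  then show ?thesis unfolding Root_def using assms by (simp add: ev_rec[where g = ?g] del: tri.simps)
qed

lemma ev_Snd [simp]:
  assumes "valuation \<rho>" shows "ap (ev \<rho> Snd) (Num a) = Num (csnd a)"
  unfolding Snd_def using assms by (simp add: csnd_def)

lemma ev_Fst [simp]:
  assumes "valuation \<rho>" shows "ap (ev \<rho> Fst) (Num a) = Num (cfst a)"
  unfolding Fst_def using assms by (simp add: cfst_def)

lemma ev_Bar [simp]:
  assumes \<rho>: "valuation \<rho>" and g: "g \<in> Tot"
  shows "ap (ap (ev \<rho> Bar) g) (Num n) = Num (bar (Fn g) n)"
proof -
  let ?g = "\<lambda>n x. Suc (cpair x (Fn g n))"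
  have "rec_nat 0 ?g n = bar (Fn g) n" by (induction n) auto
  moreover have "D T1 g g" using g by (simp add: D_T1_refl del: D.simps)
  ultimately show ?thesis unfolding Bar_def using assms
    by (simp add: ev_rec[where g = ?g] del: D.simps(2))
qed

lemma ev_tuple:
  assumes "valuation \<rho>" "list_all2 (\<lambda>t n. ev \<rho> t = Num n) ts ns"
  shows "ev \<rho> (tuple ts) = Num (ctuple ns)"
  using assms(2)
proof (induction ts arbitrary: ns rule: tuple.induct)
  case (3 c d cs)
  from 3(2) obtain m ns' where ns: "ns = m # ns'" "ev \<rho> c = Num m"
    "list_all2 (\<lambda>t n. ev \<rho> t = Num n) (d # cs) ns'"
    by (auto simp: list_all2_Cons1)
  then obtain n ns'' where "ns' = n # ns''" by (auto simp: list_all2_Cons1)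
  then show ?case using 3(1)[OF ns(3)] ns assms(1) by simp
qed (auto simp: list_all2_Cons1)

text \<open>A characteristic term with 0 for truth. The product for an implication vanishes iff the
  premise has a nonzero value or the conclusion has value 0; the clause for quantifiers is a
  dummy.\<close>

primrec chi :: "fm \<Rightarrow> tm" where
  "chi (s \<^bold>= t) = Add \<cdot> (Monus \<cdot> s \<cdot> t) \<cdot> (Monus \<cdot> t \<cdot> s)"
| "chi Falsum = One"
| "chi (\<phi> \<^bold>\<longrightarrow> \<psi>) = Mul \<cdot> (Monus \<cdot> One \<cdot> chi \<phi>) \<cdot> chi \<psi>"
| "chi (Forall v \<phi>) = Zero"

lemma wt_chi: "wff \<phi> \<Longrightarrow> wt (chi \<phi>) \<and> ty_of (chi \<phi>) = N"
  by (induction \<phi>) auto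

lemma ev_N: "wt t \<Longrightarrow> ty_of t = N \<Longrightarrow> valuation \<rho> \<Longrightarrow> \<exists>n. ev \<rho> t = Num n"
  using D_ev[of t \<rho>] by auto

lemma ev_chi: "qf \<phi> \<Longrightarrow> wff \<phi> \<Longrightarrow> valuation \<rho> \<Longrightarrow> ev \<rho> (chi \<phi>) = Num 0 \<longleftrightarrow> sat \<rho> \<phi>"
proof (induction \<phi>)
  case (Eq s t)
  then obtain m n where "ev \<rho> s = Num m" "ev \<rho> t = Num n" using ev_N by (metis wff.simps(1))
  then show ?case using Eq.prems by auto
next
  case (Imp \<phi> \<psi>)
  then obtain m n where "ev \<rho> (chi \<phi>) = Num m" "ev \<rho> (chi \<psi>) = Num n"
    using ev_N wt_chi by (metis wff.simps(3))
  then show ?case using Imp by auto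
qed auto

text \<open>An extensional choice operator for decidable nonempty sets of objects of type
  \<open>\<tau>\<close>: the chosen zero \<open>e\<close> is literally the same for all codes
  \<open>b\<close> of the same set.\<close>

definition selects :: "ty \<Rightarrow> code \<Rightarrow> bool" where
  "selects \<tau> s \<longleftrightarrow> (\<forall>a d. D (\<tau> \<rightarrow>\<^sub>t N) a a \<longrightarrow> D \<tau> d d \<longrightarrow> ap a d = Num 0 \<longrightarrow>
     (\<exists>e. D \<tau> e e \<and> ap a e = Num 0 \<and> (\<forall>b. D (\<tau> \<rightarrow>\<^sub>t N) a b \<longrightarrow> (s, b, e) \<in> Graph)))"

lemma D_N_eq: "D (\<tau> \<rightarrow>\<^sub>t N) a b \<Longrightarrow> D \<tau> c c \<Longrightarrow> (a, c, Num m) \<in> Graph \<Longrightarrow> (b, c, Num m) \<in> Graph"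
  unfolding D.simps using functionalD[OF functional_Graph] by blast

lemma ty_neq_Fun: "\<sigma> \<noteq> \<sigma> \<rightarrow>\<^sub>t \<tau>"
  by (induction \<sigma> arbitrary: \<tau>) auto

lemma selects_Sel: "selects T1 Sel"
  unfolding selects_def
proof (intro allI impI)
  fix a d assume a: "D (T1 \<rightarrow>\<^sub>t N) a a" and d: "D T1 d d" "ap a d = Num 0"
  have "\<exists>m. (a, e, Num m) \<in> Graph" if "e \<in> Tot" for e
  proof -
    have e: "D T1 e e" using that by (simp add: D_T1_refl del: D.simps)
    show ?thesis using D_Graph[OF a e] D_ap[OF a e] by auto
  qed
  moreover have "d \<in> Tot" "(a, d, Num 0) \<in> Graph"
    using d D_Graph[OF a d(1)] by (simp_all add: D_T1_refl del: D.simps)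
  ultimately obtain e where e: "e \<in> Tot" "(a, e, Num 0) \<in> Graph"
    and sel: "\<And>b. (\<And>c m. c \<in> Tot \<Longrightarrow> (a, c, Num m) \<in> Graph \<Longrightarrow> (b, c, Num m) \<in> Graph) \<Longrightarrow> (Sel, b, e) \<in> Graph"
    using Graph_Sel[of a d] by blast
  have "(Sel, b, e) \<in> Graph" if "D (T1 \<rightarrow>\<^sub>t N) a b" for b
    using D_N_eq[OF that] by (intro sel) (simp add: D_T1_refl del: D.simps)
  then show "\<exists>e. D T1 e e \<and> ap a e = Num 0 \<and> (\<forall>b. D (T1 \<rightarrow>\<^sub>t N) a b \<longrightarrow> (Sel, b, e) \<in> Graph)"
    using e ap_eq D_T1_refl by blast
qed

lemma selects_SelN: "selects N SelN"
  unfolding selects_def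
proof (intro allI impI)
  fix a d assume a: "D (N \<rightarrow>\<^sub>t N) a a" and "D N d d" "ap a d = Num 0"
  have n: "D N (Num n) (Num n)" for n by simp
  have "\<exists>m. (a, Num n, Num m) \<in> Graph" for n
    using D_Graph[OF a n, of n] D_ap[OF a n, of n] by auto
  moreover obtain k where "(a, Num k, Num 0) \<in> Graph"
    using D_Graph[OF a \<open>D N d d\<close>] \<open>ap a d = Num 0\<close> \<open>D N d d\<close> by auto
  ultimately obtain k where k: "(a, Num k, Num 0) \<in> Graph"
    and sel: "\<And>b. (\<And>n m. (a, Num n, Num m) \<in> Graph \<Longrightarrow> (b, Num n, Num m) \<in> Graph) \<Longrightarrow> (SelN, b, Num k) \<in> Graph"
    using Graph_SelN[of a k] by blast
  have "(SelN, b, Num k) \<in> Graph" if "D (N \<rightarrow>\<^sub>t N) a b" for b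
    using D_N_eq[OF that n] by (intro sel)
  then show "\<exists>e. D N e e \<and> ap a e = Num 0 \<and> (\<forall>b. D (N \<rightarrow>\<^sub>t N) a b \<longrightarrow> (SelN, b, e) \<in> Graph)"
    using k ap_eq n by blast
qed

text \<open>The matrix is decided by a term, so its set of witnesses for \<open>c\<close> has the
  code \<open>ap t c\<close>, and \<open>s\<close> picks one of them. As \<open>s\<close> depends
  only on the extension of that set, the choice functional is extensional, whatever the type
  \<open>\<sigma>\<close>.\<close>

lemma sat_QF_AC:
  assumes s: "selects \<tau> s" and "\<psi> \<in> QF_AC \<sigma> \<tau>" and \<rho>: "valuation \<rho>"
  shows "sat \<rho> \<psi>"
proof -
  obtain x y \<Phi> \<phi> where \<psi>: "\<psi> = (Forall x (Exists y \<phi>) \<^bold>\<longrightarrow>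
      Exists \<Phi> (Forall x (subst y (Var \<Phi> \<cdot> Var x) \<phi>)))"
    and \<phi>: "qf \<phi>" "wff \<phi>" and ty: "snd x = \<sigma>" "snd y = \<tau>" "snd \<Phi> = \<sigma> \<rightarrow>\<^sub>t \<tau>"
    and vars: "x \<noteq> y" "\<Phi> \<notin> fv \<phi>"
    using assms(2) unfolding QF_AC_def by blast
  have "x \<noteq> \<Phi>" using ty ty_neq_Fun by metis
  define t where "t = ev \<rho> (lam x (lam y (chi \<phi>)))"
  have t: "D (\<sigma> \<rightarrow>\<^sub>t \<tau> \<rightarrow>\<^sub>t N) t t"
    unfolding t_def using D_ev[of "lam x (lam y (chi \<phi>))" \<rho>] wt_chi \<phi>(2) \<rho> ty by (simp del: D.simps)
  have chi: "ap (ap t c) d = Num 0 \<longleftrightarrow> sat (\<rho>(x := c, y := d)) \<phi>" if "D \<sigma> c c" "D \<tau> d d" for c d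
    unfolding t_def using that ty wt_chi[OF \<phi>(2)] \<rho> ev_chi[OF \<phi>, of "\<rho>(x := c, y := d)"]
    by (simp del: fun_upd_apply)
  \<comment> \<open>The code of \<open>c \<mapsto> s \<cdot> (t \<cdot> c)\<close>. The operator
    \<open>s\<close> is only known to be defined on nonempty sets, so totality of \<open>F\<close>
    rests on the premise of the axiom.\<close>
  define F where "F = CS2 (CK1 s) t"
  show ?thesis unfolding \<psi>
  proof (simp add: ty del: D.simps, intro impI)
    assume ex: "\<forall>c. D \<sigma> c c \<longrightarrow> (\<exists>d. D \<tau> d d \<and> sat (\<rho>(x := c, y := d)) \<phi>)"
    have F: "\<exists>e. D \<tau> e e \<and> ap (ap t c) e = Num 0 \<and> (\<forall>d. D \<sigma> c d \<longrightarrow> (F, d, e) \<in> Graph)"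
      if c: "D \<sigma> c c" for c
    proof -
      obtain d where "D \<tau> d d" "ap (ap t c) d = Num 0" using ex chi c by blast
      then obtain e where e: "D \<tau> e e" "ap (ap t c) e = Num 0"
        "\<And>b. D (\<tau> \<rightarrow>\<^sub>t N) (ap t c) b \<Longrightarrow> (s, b, e) \<in> Graph"
        using s D_ap[OF t c] unfolding selects_def by blast
      have "(F, d, e) \<in> Graph" if "D \<sigma> c d" for d
        unfolding F_def
        using Graph_simple(2) D_Graph[OF t D_sym[OF that]] e(3)[OF D_ap[OF t that]] by (rule Graph_CS2)
      with e show ?thesis by blast
    qed
    have "D (\<sigma> \<rightarrow>\<^sub>t \<tau>) F F"
    proof (rule D_FunI)
      fix c d assume cd: "D \<sigma> c d"
      from F[OF D_refl_left[OF cd]] show "\<exists>u v. (F, c, u) \<in> Graph \<and> (F, d, v) \<in> Graph \<and> D \<tau> u v"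
        using cd D_refl_left by blast
    qed
    moreover have "sat (\<rho>(\<Phi> := F, x := c)) (subst y (Var \<Phi> \<cdot> Var x) \<phi>)" if c: "D \<sigma> c c" for c
    proof -
      obtain e where "D \<tau> e e" "ap (ap t c) e = Num 0" "(F, c, e) \<in> Graph" using F c by blast
      then have "sat (\<rho>(x := c, y := ap F c)) \<phi>" using chi c ap_eq by blast
      then have "sat ((\<rho>(x := c, y := ap F c))(\<Phi> := F)) \<phi>" using sat_upd[OF vars(2)] by blast
      moreover have "sat ((\<rho>(x := c, y := ap F c))(\<Phi> := F)) \<phi> \<longleftrightarrow> sat (\<rho>(\<Phi> := F, x := c, y := ap F c)) \<phi>"
        by (rule sat_cong) (use vars in auto)
      ultimately show ?thesis using \<open>x \<noteq> \<Phi>\<close> by (simp add: sat_subst free_for_qf \<phi>(1))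
    qed
    ultimately show "\<exists>F. D (\<sigma> \<rightarrow>\<^sub>t \<tau>) F F \<and>
        (\<forall>c. D \<sigma> c c \<longrightarrow> sat (\<rho>(\<Phi> := F, x := c)) (subst y (Var \<Phi> \<cdot> Var x) \<phi>))"
      by blast
  qed
qed

text \<open>The Tarski-Vaught criterion: the Skolem oracle with parameters \<open>cs\<close> yields
  a witness or a counterexample inside \<open>Tot\<close> whenever there is one at all.\<close>

lemma proj_true_Tot:
  assumes "set cs \<subseteq> Tot"
  shows "(\<exists>c\<in>Tot. proj_true False m (map Fn cs @ [Fn c])) \<longleftrightarrow> proj_true True (Suc m) (map Fn cs)"
    and "(\<forall>c\<in>Tot. proj_true True m (map Fn cs @ [Fn c])) \<longleftrightarrow> proj_true False (Suc m) (map Fn cs)"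
proof -
  let ?c = "\<lambda>b. Orc (Skolem b m) cs"
  have "proj_true False m (map Fn cs @ [Fn (?c True)])" if "\<exists>g. proj_true False m (map Fn cs @ [g])"
    unfolding Tot_Orc(2)[OF assms] oracle_fun.simps using that by (rule someI_ex)
  then show "(\<exists>c\<in>Tot. proj_true False m (map Fn cs @ [Fn c])) \<longleftrightarrow> proj_true True (Suc m) (map Fn cs)"
    using Tot_Orc(1)[OF assms] by auto
  have "\<not> proj_true True m (map Fn cs @ [Fn (?c False)])" if "\<exists>g. \<not> proj_true True m (map Fn cs @ [g])"
    unfolding Tot_Orc(2)[OF assms] oracle_fun.simps using that by (rule someI_ex)
  then show "(\<forall>c\<in>Tot. proj_true True m (map Fn cs @ [Fn c])) \<longleftrightarrow> proj_true False (Suc m) (map Fn cs)"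
    using Tot_Orc(1)[OF assms] by auto
qed

text \<open>Quantifiers of the model range over \<open>Tot\<close>, those of
  \<open>proj_true\<close> over all functions; \<open>proj_true_Tot\<close> bridges the two at each
  of the \<open>k - i\<close> function quantifiers still to be read, the first \<open>i\<close>
  being already evaluated by the valuation.\<close>

lemma sat_alternating:
  fixes k
  defines "matr \<equiv> (V k T1 \<cdot> tuple (map (\<lambda>i. Bar \<cdot> V i T1 \<cdot> n0) [0..<k]) \<^bold>= Zero)"
  assumes "valuation \<rho>" "i \<le> k"
  shows "sat \<rho> (alternating b (map (\<lambda>i. (i, T1)) [i..<k] @ [(0, N)]) matr) \<longleftrightarrow>
    proj_true b (k - i) (map Fn (\<rho> (k, T1) # map (\<lambda>j. \<rho> (j, T1)) [0..<i]))"
  using assms(2,3)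
proof (induction "k - i" arbitrary: i b \<rho>)
  case 0
  then have i: "i = k" by simp
  let ?fs = "map Fn (\<rho> (k, T1) # map (\<lambda>j. \<rho> (j, T1)) [0..<k])"
  have "sat (\<rho>((0, N) := Num n)) matr \<longleftrightarrow> matrix ?fs n" for n
  proof -
    have \<rho>: "valuation (\<rho>((0, N) := Num n))" using 0 by simp
    have "ev (\<rho>((0, N) := Num n)) (tuple (map (\<lambda>i. Bar \<cdot> V i T1 \<cdot> n0) [0..<k]))
        = Num (ctuple (map (\<lambda>i. bar (Fn (\<rho> (i, T1))) n) [0..<k]))"
      using \<rho> 0 by (intro ev_tuple) (auto simp: list_all2_map1 list_all2_map2 list_all2_same)
    then show ?thesis using 0 by (simp add: matr_def matrix_def comp_def)
  qed
  then show ?case using i by (cases b) auto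
next
  case (Suc m)
  then have i: "i < k" by simp
  let ?cs = "\<rho> (k, T1) # map (\<lambda>j. \<rho> (j, T1)) [0..<i]"
  have cs: "set ?cs \<subseteq> Tot" using Suc.prems by auto
  have IH: "sat (\<rho>((i, T1) := c)) (alternating b (map (\<lambda>i. (i, T1)) [Suc i..<k] @ [(0, N)]) matr) \<longleftrightarrow>
      proj_true b m (map Fn ?cs @ [Fn c])" if "c \<in> Tot" for b c
  proof -
    have "m = k - Suc i" "valuation (\<rho>((i, T1) := c))" "Suc i \<le> k"
      using Suc that i D_T1_refl[of c] by (auto simp del: D.simps)
    note IH = Suc.hyps(1)[OF this]
    have "map Fn ((\<rho>((i, T1) := c)) (k, T1) # map (\<lambda>j. (\<rho>((i, T1) := c)) (j, T1)) [0..<Suc i])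
        = map Fn ?cs @ [Fn c]"
      using i by simp
    then show ?thesis using IH \<open>m = k - Suc i\<close> by metis
  qed
  have "[i..<k] = i # [Suc i..<k]" using i by (rule upt_conv_Cons)
  then have "sat \<rho> (alternating b (map (\<lambda>i. (i, T1)) [i..<k] @ [(0, N)]) matr) \<longleftrightarrow>
      (if b then \<exists>c\<in>Tot. proj_true False m (map Fn ?cs @ [Fn c])
       else \<forall>c\<in>Tot. proj_true True m (map Fn ?cs @ [Fn c]))"
    using IH by (cases b) (auto simp: D_T1_refl simp del: D.simps fun_upd_apply)
  also have "\<dots> \<longleftrightarrow> proj_true b (Suc m) (map Fn ?cs)"
    unfolding proj_true_Tot[OF cs] by (cases b) simp_all
  finally show ?case using Suc.hyps(2) by simp
qed

lemma D_T2I: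
  assumes "\<And>c. c \<in> Tot \<Longrightarrow> (a, c, Num (f (Fn c))) \<in> Graph"
  shows "D T2 a a"
proof (rule D_FunI)
  fix c d assume "D T1 c d"
  then have "c \<in> Tot" "d \<in> Tot" "Fn c = Fn d" by (simp_all add: D_T1_iff del: D.simps)
  then show "\<exists>u v. (a, c, u) \<in> Graph \<and> (a, d, v) \<in> Graph \<and> D N u v"
    using assms[of c] assms[of d] by auto
qed

text \<open>The functional is \<open>Dec (Truth k)\<close>. It answers by truth over all functions,
  which \<open>sat_alternating\<close> identifies with truth in the model.\<close>

lemma sat_S2:
  assumes \<rho>: "valuation \<rho>"
  shows "sat \<rho> (S2 k)"
proof -
  let ?d = "Dec (Truth k)"
  have "D T2 ?d ?d" using Graph_Dec by (rule D_T2I)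
  moreover have "ap ?d c = Num (if proj_true True k [Fn c] then 0 else 1)" if "c \<in> Tot" for c
    using ap_eq[OF Graph_Dec[OF that]] by simp
  moreover have "sat (\<rho>((0, T2) := ?d, (k, T1) := c)) (sigma1 k) \<longleftrightarrow> proj_true True k [Fn c]"
    if "c \<in> Tot" for c
  proof -
    have "valuation (\<rho>((0, T2) := ?d, (k, T1) := c))"
      using \<rho> \<open>D T2 ?d ?d\<close> that D_T1_refl[of c] by (simp del: D.simps)
    from sat_alternating[OF this, of 0 k True] show ?thesis by (simp add: sigma1_def)
  qed
  ultimately show ?thesis unfolding S2_def
    by (auto simp: D_T1_refl One_def simp del: D.simps intro!: exI[of _ ?d] split: if_splits)
qed

section \<open>The reals of the model\<close>

definition ccross :: "nat \<Rightarrow> nat \<Rightarrow> nat" where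
  "ccross q r = cfst q * Suc (csnd (csnd r)) + cfst (csnd r) * Suc (csnd (csnd q))"

lemma ev_cross:
  assumes "valuation \<rho>" "ev \<rho> q = Num a" "ev \<rho> r = Num b"
  shows "ev \<rho> (cross q r) = Num (ccross a b)"
  using assms by (simp add: cross_def ccross_def)

lemma rat_of_diff:
  "rat_of a - rat_of b = (real (ccross a b) - real (ccross b a)) /
     (real (Suc (csnd (csnd a))) * real (Suc (csnd (csnd b))))"
  unfolding rat_of_def ccross_def diff_frac_eq[OF of_nat_neq_0 of_nat_neq_0]
  by (simp add: algebra_simps)

text \<open>Clearing denominators, with the negative part moved to the other side, since subtraction
  on the natural numbers is truncated.\<close>

lemma nat_less_iff_frac:
  assumes "d > 0"
  shows "x * 2 ^ k < y * 2 ^ k + d \<longleftrightarrow> (real x - real y) / real d < 1 / 2 ^ k"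
proof -
  have "x * 2 ^ k < y * 2 ^ k + d \<longleftrightarrow> real (x * 2 ^ k) < real (y * 2 ^ k + d)"
    by (simp only: of_nat_less_iff)
  also have "\<dots> \<longleftrightarrow> (real x - real y) / real d < 1 / 2 ^ k"
    using assms by (simp add: divide_simps algebra_simps)
  finally show ?thesis .
qed

lemma nat_le_iff_frac:
  assumes "d > 0"
  shows "x * 2 ^ k \<le> y * 2 ^ k + 2 * d \<longleftrightarrow> (real x - real y) / real d \<le> 2 / 2 ^ k"
proof -
  have "x * 2 ^ k \<le> y * 2 ^ k + 2 * d \<longleftrightarrow> real (x * 2 ^ k) \<le> real (y * 2 ^ k + 2 * d)"
    by (simp only: of_nat_le_iff)
  also have "\<dots> \<longleftrightarrow> (real x - real y) / real d \<le> 2 / 2 ^ k"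
    using assms by (simp add: divide_simps algebra_simps)
  finally show ?thesis .
qed

lemma sat_diff_less:
  assumes "valuation \<rho>" "ev \<rho> q = Num a" "ev \<rho> r = Num b" "ev \<rho> n = Num k"
  shows "sat \<rho> (diff_less q r n) \<longleftrightarrow> rat_of a - rat_of b < 1 / 2 ^ k"
proof -
  let ?d = "Suc (csnd (csnd a)) * Suc (csnd (csnd b))"
  have "sat \<rho> (diff_less q r n) \<longleftrightarrow> ccross a b * 2 ^ k < ccross b a * 2 ^ k + ?d"
    using assms by (simp add: diff_less_def le_tm_def ev_cross Suc_le_eq del: mult_Suc mult_Suc_right)
  also have "\<dots> \<longleftrightarrow> (real (ccross a b) - real (ccross b a)) / real ?d < 1 / 2 ^ k"
    by (rule nat_less_iff_frac) simp
  finally show ?thesis by (simp only: rat_of_diff of_nat_mult)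
qed

lemma sat_diff_le2:
  assumes "valuation \<rho>" "ev \<rho> q = Num a" "ev \<rho> r = Num b" "ev \<rho> n = Num k"
  shows "sat \<rho> (diff_le2 q r n) \<longleftrightarrow> rat_of a - rat_of b \<le> 2 / 2 ^ k"
proof -
  let ?d = "Suc (csnd (csnd a)) * Suc (csnd (csnd b))"
  have "sat \<rho> (diff_le2 q r n) \<longleftrightarrow> ccross a b * 2 ^ k \<le> ccross b a * 2 ^ k + 2 * ?d"
    using assms by (simp add: diff_le2_def le_tm_def ev_cross numeral_2_eq_2[symmetric]
        del: mult_Suc mult_Suc_right)
  also have "\<dots> \<longleftrightarrow> (real (ccross a b) - real (ccross b a)) / real ?d \<le> 2 / 2 ^ k"
    by (rule nat_le_iff_frac) simp
  finally show ?thesis by (simp only: rat_of_diff of_nat_mult)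
qed

lemma sat_is_real:
  assumes \<rho>: "valuation \<rho>"
  shows "sat \<rho> (is_real (V j T1)) \<longleftrightarrow> real_code (Fn (\<rho> (j, T1)))"
proof -
  have "\<rho> (j, T1) \<in> Tot" using \<rho> by simp
  then have "sat (\<rho>((0, N) := Num n, (1, N) := Num i))
      (diff_less (V j T1 \<cdot> n0) (V j T1 \<cdot> (Add \<cdot> n0 \<cdot> n1)) n0 \<^bold>\<and>
       diff_less (V j T1 \<cdot> (Add \<cdot> n0 \<cdot> n1)) (V j T1 \<cdot> n0) n0) \<longleftrightarrow>
      \<bar>rat_of (Fn (\<rho> (j, T1)) n) - rat_of (Fn (\<rho> (j, T1)) (n + i))\<bar> < 1 / 2 ^ n" for n i
    using \<rho> by (simp add: sat_diff_less[where a = "Fn (\<rho> (j, T1)) n" and b = "Fn (\<rho> (j, T1)) (n + i)" and k = n]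
        sat_diff_less[where b = "Fn (\<rho> (j, T1)) n" and a = "Fn (\<rho> (j, T1)) (n + i)" and k = n] abs_less_iff)
  then show ?thesis unfolding is_real_def real_code_def by auto
qed

lemma sat_eq_real:
  assumes \<rho>: "valuation \<rho>" and real: "real_code (Fn (\<rho> (i, T1)))" "real_code (Fn (\<rho> (j, T1)))"
  shows "sat \<rho> (eq_real (V i T1) (V j T1)) \<longleftrightarrow>
    real_of_code (Fn (\<rho> (i, T1))) = real_of_code (Fn (\<rho> (j, T1)))"
proof -
  have "\<rho> (i, T1) \<in> Tot" "\<rho> (j, T1) \<in> Tot" using \<rho> by simp_all
  then have "sat (\<rho>((0, N) := Num n))
      (diff_le2 (V i T1 \<cdot> n0) (V j T1 \<cdot> n0) n0 \<^bold>\<and> diff_le2 (V j T1 \<cdot> n0) (V i T1 \<cdot> n0) n0) \<longleftrightarrow>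
      \<bar>rat_of (Fn (\<rho> (i, T1)) n) - rat_of (Fn (\<rho> (j, T1)) n)\<bar> \<le> 2 / 2 ^ n" for n
    using \<rho> by (simp add: sat_diff_le2[where a = "Fn (\<rho> (i, T1)) n" and b = "Fn (\<rho> (j, T1)) n" and k = n]
        sat_diff_le2[where a = "Fn (\<rho> (j, T1)) n" and b = "Fn (\<rho> (i, T1)) n" and k = n] abs_le_iff)
  then show ?thesis unfolding eq_real_def real_code_eq_iff[OF real] by auto
qed

text \<open>The counterexample is \<open>Index\<close>: it numbers the canonical representation of
  its argument, so on representations of reals it respects equality of reals and is injective up to
  that equality.\<close>

lemma not_sat_NIN:
  assumes \<rho>: "valuation \<rho>"
  shows "\<not> sat \<rho> NIN"
proof -
  obtain i where i: "\<And>c. c \<in> Tot \<Longrightarrow> (Index, c, Num (i (oracle_fun Canon [Fn c]))) \<in> Graph"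
    and inj: "inj_on i (Fn ` Tot)"
    using Graph_Index by blast
  have Index: "D T2 Index Index"
    by (rule D_T2I[of Index "\<lambda>f. i (oracle_fun Canon [f])"]) (rule i)
  \<comment> \<open>From right to left this makes \<open>Index\<close> a function on the unit
    interval; from left to right it refutes the conclusion of \<open>NIN\<close>.\<close>
  have key: "ap Index c = ap Index d \<longleftrightarrow> real_of_code (Fn c) = real_of_code (Fn d)"
    if "c \<in> Tot" "d \<in> Tot" "real_code (Fn c)" "real_code (Fn d)" for c d
  proof -
    have canon: "oracle_fun Canon [Fn e] \<in> Fn ` Tot" if "e \<in> Tot" for e
      using Tot_Orc[of "[e]" Canon] that by (auto simp del: oracle_fun.simps intro!: image_eqI[of _ _ "Orc Canon [e]"])
    have "ap Index c = ap Index d \<longleftrightarrow> oracle_fun Canon [Fn c] = oracle_fun Canon [Fn d]"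
      using ap_eq[OF i[OF that(1)]] ap_eq[OF i[OF that(2)]]
        inj_on_eq_iff[OF inj canon[OF that(1)] canon[OF that(2)]] by (simp del: oracle_fun.simps)
    then show ?thesis using canon_eq_iff[OF that(3,4)] by simp
  qed
  let ?\<rho> = "\<lambda>c d. \<rho>((0, T2) := Index, (0, T1) := c, (1, T1) := d)"
  have val: "valuation (?\<rho> c d)" if "c \<in> Tot" "d \<in> Tot" for c d
    using \<rho> that Index D_T1_refl by (simp del: D.simps)
  have real: "real_code (Fn c)" "real_code (Fn d)"
    if "c \<in> Tot" "d \<in> Tot" "sat (?\<rho> c d) (in_unit_interval (V 0 T1))" "sat (?\<rho> c d) (in_unit_interval (V 1 T1))" for c d
    using that sat_is_real[OF val[OF that(1,2)], of 0] sat_is_real[OF val[OF that(1,2)], of 1]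
    by (simp_all add: in_unit_interval_def del: One_nat_def)
  have eq: "sat (?\<rho> c d) (eq_real (V 0 T1) (V 1 T1)) \<longleftrightarrow> ap Index c = ap Index d"
    if "c \<in> Tot" "d \<in> Tot" "sat (?\<rho> c d) (in_unit_interval (V 0 T1))" "sat (?\<rho> c d) (in_unit_interval (V 1 T1))" for c d
    using sat_eq_real[OF val[OF that(1,2)], of 0 1] real[OF that] key[OF that(1,2)] by simp
  have "sat (\<rho>((0, T2) := Index)) (fun_unit_interval_nat (V 0 T2))"
    unfolding fun_unit_interval_nat_def
    by (auto simp: D_T1_refl eq simp del: D.simps One_nat_def fun_upd_apply) simp
  moreover have "\<not> sat (\<rho>((0, T2) := Index)) (Exists (0, T1) (Exists (1, T1)
       (in_unit_interval (V 0 T1) \<^bold>\<and> in_unit_interval (V 1 T1) \<^bold>\<and>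
        (\<^bold>\<not> eq_real (V 0 T1) (V 1 T1)) \<^bold>\<and> V 0 T2 \<cdot> V 0 T1 \<^bold>= V 0 T2 \<cdot> V 1 T1)))"
    by (auto simp: D_T1_refl eq simp del: D.simps One_nat_def fun_upd_apply) simp
  ultimately show ?thesis unfolding NIN_def using Index by (auto simp del: D.simps sat_simps)
qed

theorem theorem2p12:
  shows "\<not> ((Z2_omega \<union> (\<Union>\<sigma>. QF_AC \<sigma> T1)) \<turnstile> NIN)"
proof
  assume "(Z2_omega \<union> (\<Union>\<sigma>. QF_AC \<sigma> T1)) \<turnstile> NIN"
  \<comment> \<open>Choice of functions is served by \<open>Sel\<close>, and the choice of numbers
    in the base theory by \<open>SelN\<close>.\<close>
  moreover have "sat \<rho> \<phi>" if "\<phi> \<in> Z2_omega \<union> (\<Union>\<sigma>. QF_AC \<sigma> T1)" "valuation \<rho>" for \<phi> \<rho>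
    using that sat_E_PRA sat_QF_AC[OF selects_Sel] sat_QF_AC[OF selects_SelN] sat_S2
    unfolding Z2_omega_def Pi1_CA0_omega_def RCA0_omega_def by blast
  ultimately show False using soundness not_sat_NIN valuation_exists by blast
qed

end
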